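(* Let $X$ be a finite connected graph whose Euler characteristic $\chi(X)$ does not vanish, and let $\alpha\colon\mathbf{E}_X\to\mathbb{Z}$ be a voltage assignment such that $X(\mathbb{Z},\alpha)$ is connected. For $n\in\mathbb{N}$ let $X_n := X(\mathbb{Z}/n\mathbb{Z},\pi_n\circ\alpha)$, where $\pi_n\colon\mathbb{Z}\to\mathbb{Z}/n\mathbb{Z}$ is the quotient map. Let $\mathcal{I}_\alpha\in\mathbb{Z}[t^{\pm1}]$ be the Ihara polynomial associated to $\alpha$, and set $J_\alpha(t) := t^b(t-1)^{-e}\mathcal{I}_\alpha(t)$, where $b := -\mathrm{ord}_{t=0}(\mathcal{I}_\alpha)$ and $e := \mathrm{ord}_{t=1}(\mathcal{I}_\alpha)$. Fix a rational prime $p$ and an algebraic closure $\overline{\mathbb{Q}}_p$ of $\mathbb{Q}_p$. Define $$\mu_p(X,\alpha) := -m_p(J_\alpha)/\log(p),\qquad c_p(X,\alpha) := \mathrm{ord}_p(\kappa(X))-\mathrm{ord}_p(\Delta_1(J_\alpha)).$$ Let $\beta_1,\dots,\beta_d\in\overline{\mathbb{Q}}_p$ be the $p$-adic roots of $J_\alpha$, counted with multiplicity. For every $n\in\mathbb{N}$ let $$B_{p,n}(X,\alpha) := \{\beta\in\overline{\mathbb{Q}}_p: J_\alpha(\beta)=0,\ |\beta|_p=1,\ |\beta^n-1|_p<1\},$$ $$\lambda_{p,n}(X,\alpha) := \#\{j\in\{1,\dots,d\}:\beta_j\in B_{p,n}(X,\alpha)\}+e-1.$$ For every $\beta\in\overline{\mathbb{Q}}_p$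 with $|\beta|_p=1$ let $$s_p(\beta) := \min\{s\in\mathbb{Z}_{\ge0}: p^s(p-1)\,\mathrm{ord}_p(\beta-\tau_p(\pi_p(\beta)))>1\},$$ and for $n\in\mathbb{N}$ set $r_{p,n}(\beta) := \min(\mathrm{ord}_p(n),s_p(\beta))$, where $\tau_p(\pi_p(\beta))$ is the Teichmüller lift of the reduction $\pi_p(\beta)$ of $\beta$. Let $$\nu_{p,n}(X,\alpha) := \sum_{\substack{j\in\{1,\dots,d\}\\ \beta_j\in B_{p,n}(X,\alpha)}}\left(\mathrm{ord}_p\!\left(\beta_j^{p^{r_{p,n}(\beta_j)}}-\tau_p(\pi_p(\beta_j))^{p^{r_{p,n}(\beta_j)}}\right)-r_{p,n}(\beta_j)\right).$$ Then $$\mathrm{ord}_p(\kappa(X_n))=\mu_p(X,\alpha)\cdot n+\lambda_{p,n}(X,\alpha)\cdot\mathrm{ord}_p(n)+\nu_{p,n}(X,\alpha)+c_p(X,\alpha)$$ for every $n\in\mathbb{N}$.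
   Context: $\mathbb{N}=\{1,2,\dots\}$. $\mathrm{ord}_p$ and $|\cdot|_p$ are the $p$-adic valuation and absolute value on $\overline{\mathbb{Q}}_p$ and its completion $\mathbb{C}_p$, with $\mathrm{ord}_p(p)=1$ and $|x|_p=p^{-\mathrm{ord}_p(x)}$. Let $\mathcal{O}_p$ be the valuation ring of $\overline{\mathbb{Q}}_p$, $\pi_p\colon\mathcal{O}_p\to\overline{\mathbb{F}}_p$ the reduction modulo its maximal ideal, and $\tau_p\colon\overline{\mathbb{F}}_p^\times\to\mathcal{O}_p^\times$ the Teichmüller lift, i.e. the group homomorphism sending $x$ to the unique root of unity of order prime to $p$ whose reduction is $x$. Graphs are in the sense of Serre: a graph $X$ consists of a set $V_X$ of vertices, a set $\mathbf{E}_X$ of directed edges, origin and terminus maps $o,t\colon\mathbf{E}_X\to V_X$, and an inversion $e\mapsto\bar e$ on $\mathbf{E}_X$ with $o(\bar e)=t(e)$, $t(\bar e)=o(e)$ and $\bar{\bar e}=e\ne\bar e$. Loops and multiple edges are allowed. $X$ is finite if $V_X$ and $\mathbf{E}_X$ are finite, and connected if any two vertices are joined by a path of directed edges. $\chi(X)=|V_X|-|\mathbf{E}_X|/2$, and $\kappa(X)$ is the number of spanning trees of a finite graph $X$. A voltage assignment with values in a group $G$ is a function $\alpha\colon\mathbf{E}_X\to G$ with $\alpha(\bar e)=\alpha(e)^{-1}$ for all $e$. The graph $X(G,\alpha)$ has vertex set $V_X\times G$, edge set $\mathbf{E}_X\times G$, and $o(e,\sigma)=(o(e),\sigma)$, $t(e,\sigma)=(t(e),\sigma\cdot\alpha(e))$,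 $\overline{(e,\sigma)}=(\bar e,\sigma\cdot\alpha(e))$. Ihara polynomial of $\alpha\colon\mathbf{E}_X\to\mathbb{Z}$: order $V_X=\{v_1,\dots,v_g\}$, let $D_X$ be the diagonal matrix with entries $\#\{e\in\mathbf{E}_X: o(e)=v_i\}$, and let $A_\alpha(t)$ be the $g\times g$ matrix with $(i,j)$ entry $\sum_{e:\,o(e)=v_i,\,t(e)=v_j}t^{\alpha(e)}$; then $\mathcal{I}_\alpha(t)=\det(D_X-A_\alpha(t))\in\mathbb{Z}[t^{\pm1}]$. $\mathrm{ord}_{t=a}$ denotes the order of vanishing at $t=a$. For a nonzero polynomial $g(t)=b_d\prod_{i=1}^d(t-\beta_i)\in\mathbb{C}_p[t]$, $M_p(g)=|b_d|_p\prod_{i=1}^d\max\{1,|\beta_i|_p\}$ and $m_p(g)=\log M_p(g)$. For $f(t)=a_d\prod_{i=1}^d(t-\alpha_i)\in\mathbb{Z}[t]$ with $a_d\ne0$, the Pierce-Lehmer sequence is $\Delta_n(f)=a_d^n\prod_{i=1}^d(\alpha_i^n-1)\in\mathbb{Z}$. *)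

theory Defs
  imports
    "HOL-Library.Extended_Real"
    "HOL-Library.Poly_Mapping"
    "HOL-Algebra.Elementary_Groups"
    "HOL-Computational_Algebra.Computational_Algebra"
    "Jordan_Normal_Form.Determinant"
begin

section \<open>Graphs in the sense of Serre\<close>

record ('v, 'e) pregraph =
  verts :: "'v set"
  edges :: "'e set"
  origin :: "'e \<Rightarrow> 'v"
  terminus :: "'e \<Rightarrow> 'v"
  inversion :: "'e \<Rightarrow> 'e"

definition serre_graph :: "('v, 'e) pregraph \<Rightarrow> bool" where
  "serre_graph X \<longleftrightarrow>
     (\<forall>e\<in>edges X. origin X e \<in> verts X \<and> terminus X e \<in> verts X \<and> inversion X e \<in> edges X \<and>
        origin X (inversion X e) = terminus X e \<and> terminus X (inversion X e) = origin X e \<and>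
        inversion X (inversion X e) = e \<and> inversion X e \<noteq> e)"

definition finite_graph :: "('v, 'e) pregraph \<Rightarrow> bool" where
  "finite_graph X \<longleftrightarrow> finite (verts X) \<and> finite (edges X)"

definition connected_graph :: "('v, 'e) pregraph \<Rightarrow> bool" where
  "connected_graph X \<longleftrightarrow>
     (\<forall>u\<in>verts X. \<forall>v\<in>verts X. (u, v) \<in> {(origin X e, terminus X e) |e. e \<in> edges X}\<^sup>*)"

definition euler_char :: "('v, 'e) pregraph \<Rightarrow> rat" where
  "euler_char X = of_nat (card (verts X)) - of_nat (card (edges X)) / 2"

text \<open>A circuit of length \<open>n \<ge> 1\<close> is a closed path through \<open>n\<close> distinct vertices without
  backtracking. Length 1 gives the loops, length 2 the pairs of distinct parallel geometric edges;
  the condition on the inversion is needed only to exclude the path \<open>e\<close>, \<open>inversion e\<close>.\<close>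

definition circuit :: "('v, 'e) pregraph \<Rightarrow> 'e list \<Rightarrow> bool" where
  "circuit X es \<longleftrightarrow> es \<noteq> [] \<and> set es \<subseteq> edges X \<and> distinct (map (origin X) es) \<and>
     (\<forall>i<length es. let f = es ! (Suc i mod length es) in
        terminus X (es ! i) = origin X f \<and> f \<noteq> inversion X (es ! i))"

definition tree :: "('v, 'e) pregraph \<Rightarrow> bool" where
  "tree X \<longleftrightarrow> verts X \<noteq> {} \<and> connected_graph X \<and> \<not> (\<exists>es. circuit X es)"

definition spanning_trees :: "('v, 'e) pregraph \<Rightarrow> 'e set set" where
  "spanning_trees X =
     {T. T \<subseteq> edges X \<and> inversion X ` T \<subseteq> T \<and> tree (X\<lparr>edges := T\<rparr>)}"

definition num_spanning_trees :: "('v, 'e) pregraph \<Rightarrow> nat" where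
  "num_spanning_trees X = card (spanning_trees X)"

section \<open>Voltage assignments and derived graphs\<close>

definition voltage_assignment ::
    "('v, 'e) pregraph \<Rightarrow> ('g, 'm) monoid_scheme \<Rightarrow> ('e \<Rightarrow> 'g) \<Rightarrow> bool" where
  "voltage_assignment X G \<alpha> \<longleftrightarrow>
     (\<forall>e\<in>edges X. \<alpha> e \<in> carrier G \<and> \<alpha> (inversion X e) = m_inv G (\<alpha> e))"

definition derived_graph ::
    "('v, 'e) pregraph \<Rightarrow> ('g, 'm) monoid_scheme \<Rightarrow> ('e \<Rightarrow> 'g) \<Rightarrow> ('v \<times> 'g, 'e \<times> 'g) pregraph" where
  "derived_graph X G \<alpha> =
     \<lparr>verts = verts X \<times> carrier G,
      edges = edges X \<times> carrier G,
      origin = (\<lambda>(e, \<sigma>). (origin X e, \<sigma>)),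
      terminus = (\<lambda>(e, \<sigma>). (terminus X e, \<sigma> \<otimes>\<^bsub>G\<^esub> \<alpha> e)),
      inversion = (\<lambda>(e, \<sigma>). (inversion X e, \<sigma> \<otimes>\<^bsub>G\<^esub> \<alpha> e))\<rparr>"

text \<open>\<open>integer_mod_group n\<close> is the additive group of residues \<open>{0..<n}\<close>, so the quotient map
  from the integers is reduction \<open>mod n\<close>.\<close>

definition mod_cover ::
    "('v, 'e) pregraph \<Rightarrow> ('e \<Rightarrow> int) \<Rightarrow> nat \<Rightarrow> ('v \<times> int, 'e \<times> int) pregraph" where
  "mod_cover X \<alpha> n = derived_graph X (integer_mod_group n) ((\<lambda>k. k mod int n) \<circ> \<alpha>)"

section \<open>The Ihara polynomial\<close>

text \<open>Laurent polynomials are finitely supported functions from exponents to coefficients, with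
  the convolution product; \<open>Poly_Mapping.single k 1\<close> is \<open>t\<^sup>k\<close>.\<close>

type_synonym int_laurent = "int \<Rightarrow>\<^sub>0 int"

definition degree_mat :: "('v, 'e) pregraph \<Rightarrow> 'v list \<Rightarrow> int_laurent mat" where
  "degree_mat X vs = mat (length vs) (length vs)
     (\<lambda>(i, j). if i = j then of_nat (card {e \<in> edges X. origin X e = vs ! i}) else 0)"

definition adjacency_mat ::
    "('v, 'e) pregraph \<Rightarrow> 'v list \<Rightarrow> ('e \<Rightarrow> int) \<Rightarrow> int_laurent mat" where
  "adjacency_mat X vs \<alpha> = mat (length vs) (length vs)
     (\<lambda>(i, j). \<Sum>e\<in>{e \<in> edges X. origin X e = vs ! i \<and> terminus X e = vs ! j}.
        Poly_Mapping.single (\<alpha> e) 1)"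

text \<open>The list \<open>vs\<close> is the chosen ordering of the vertex set.\<close>

definition ihara :: "('v, 'e) pregraph \<Rightarrow> 'v list \<Rightarrow> ('e \<Rightarrow> int) \<Rightarrow> int_laurent" where
  "ihara X vs \<alpha> = det (degree_mat X vs - adjacency_mat X vs \<alpha>)"

definition laurent_ord0 :: "int_laurent \<Rightarrow> int" where
  "laurent_ord0 L = Min (Poly_Mapping.keys L)"

text \<open>The polynomial \<open>t\<^sup>b L(t)\<close> with \<open>b = - laurent_ord0 L\<close>.\<close>

definition laurent_shift :: "int_laurent \<Rightarrow> int poly" where
  "laurent_shift L =
     (\<Sum>k\<in>Poly_Mapping.keys L. monom (Poly_Mapping.lookup L k) (nat (k - laurent_ord0 L)))"

text \<open>A power of \<open>t\<close> does not vanish at 1, so the order at 1 may be read off after the shift.\<close>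

definition laurent_ord1 :: "int_laurent \<Rightarrow> nat" where
  "laurent_ord1 L = order 1 (laurent_shift L)"

definition J_exp :: "('v, 'e) pregraph \<Rightarrow> 'v list \<Rightarrow> ('e \<Rightarrow> int) \<Rightarrow> nat" where
  "J_exp X vs \<alpha> = laurent_ord1 (ihara X vs \<alpha>)"

text \<open>The division is exact, see \<open>J_poly_mult\<close>.\<close>

definition J_poly :: "('v, 'e) pregraph \<Rightarrow> 'v list \<Rightarrow> ('e \<Rightarrow> int) \<Rightarrow> int poly" where
  "J_poly X vs \<alpha> = laurent_shift (ihara X vs \<alpha>) div [:-1, 1:] ^ J_exp X vs \<alpha>"

lemma J_poly_mult:
  "[:-1, 1:] ^ J_exp X vs \<alpha> * J_poly X vs \<alpha> = laurent_shift (ihara X vs \<alpha>)"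
  unfolding J_poly_def J_exp_def laurent_ord1_def
  by (rule dvd_mult_div_cancel) (use order_1[of "1 :: int"] in auto)

definition laurent_of_poly :: "int poly \<Rightarrow> int_laurent" where
  "laurent_of_poly f = (\<Sum>i\<le>degree f. Poly_Mapping.single (int i) (coeff f i))"

lemma poly_mapping_eq_sum_single:
  fixes L :: int_laurent
  shows "L = (\<Sum>k\<in>Poly_Mapping.keys L. Poly_Mapping.single k (Poly_Mapping.lookup L k))"
  by (rule poly_mapping_eqI)
    (simp add: lookup_sum lookup_single when_def in_keys_iff sum.delta)

lemma laurent_of_poly_eq:
  assumes "degree f \<le> n"
  shows "laurent_of_poly f = (\<Sum>i\<le>n. Poly_Mapping.single (int i) (coeff f i))"
  unfolding laurent_of_poly_def using assms
  by (intro sum.mono_neutral_left) (auto simp: coeff_eq_0)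

lemma laurent_of_poly_add: "laurent_of_poly (f + g) = laurent_of_poly f + laurent_of_poly g"
proof -
  let ?n = "max (degree f) (degree g)"
  show ?thesis
    using degree_add_le_max[of f g]
    by (simp add: laurent_of_poly_eq[of _ ?n] single_add sum.distrib)
qed

lemma laurent_of_poly_monom: "laurent_of_poly (monom c n) = Poly_Mapping.single (int n) c"
proof -
  have "laurent_of_poly (monom c n) = (\<Sum>i\<le>n. if i = n then Poly_Mapping.single (int i) c else 0)"
    unfolding laurent_of_poly_eq[OF degree_monom_le] by (intro sum.cong) auto
  then show ?thesis by simp
qed

lemma laurent_of_poly_sum:
  "laurent_of_poly (\<Sum>x\<in>A. f x) = (\<Sum>x\<in>A. laurent_of_poly (f x))"
proof (induction A rule: infinite_finite_induct)
  case (insert x A)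
  then show ?case by (simp add: laurent_of_poly_add)
qed (auto simp: laurent_of_poly_def)

lemma laurent_of_poly_shift:
  "laurent_of_poly (laurent_shift L) = Poly_Mapping.single (- laurent_ord0 L) 1 * L"
proof -
  have le: "laurent_ord0 L \<le> k" if "k \<in> Poly_Mapping.keys L" for k
    using that unfolding laurent_ord0_def by simp
  have "Poly_Mapping.single (- laurent_ord0 L) 1 * L =
      Poly_Mapping.single (- laurent_ord0 L) 1 *
        (\<Sum>k\<in>Poly_Mapping.keys L. Poly_Mapping.single k (Poly_Mapping.lookup L k))"
    using poly_mapping_eq_sum_single[of L] by simp
  also have "\<dots> = (\<Sum>k\<in>Poly_Mapping.keys L.
      Poly_Mapping.single (k - laurent_ord0 L) (Poly_Mapping.lookup L k))"
    by (simp add: sum_distrib_left mult_single)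
  also have "\<dots> = laurent_of_poly (laurent_shift L)"
    unfolding laurent_shift_def laurent_of_poly_sum laurent_of_poly_monom
    by (intro sum.cong) (use le in auto)
  finally show ?thesis by simp
qed

section \<open>Pierce-Lehmer sequences\<close>

text \<open>The roots are taken in the complex numbers; the product is an integer.\<close>

definition pierce_lehmer :: "nat \<Rightarrow> int poly \<Rightarrow> int" where
  "pierce_lehmer n f = (THE k. of_int k =
     of_int (lead_coeff f) ^ n * (\<Prod>\<alpha>\<in>#proots (map_poly of_int f :: complex poly). \<alpha> ^ n - 1))"

section \<open>The algebraic closure of the p-adic numbers\<close>

definition padic_abs_rat :: "nat \<Rightarrow> rat \<Rightarrow> real" where
  "padic_abs_rat p q = (if q = 0 then 0 else
     real p powi (int (multiplicity (int p) (snd (quotient_of q))) -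
                  int (multiplicity (int p) (fst (quotient_of q)))))"

text \<open>The topological closure of the rationals.\<close>

definition rat_closure :: "('k :: field_char_0 \<Rightarrow> real) \<Rightarrow> 'k set" where
  "rat_closure absv = {x. \<forall>\<epsilon>>0. \<exists>q. absv (x - of_rat q) < \<epsilon>}"

text \<open>The type \<open>'k\<close> is an algebraic closure of the field of \<open>p\<close>-adic numbers, and \<open>absv\<close> is the
  extension of the \<open>p\<close>-adic absolute value to it. The \<open>p\<close>-adic numbers, being the completion of
  the rationals, are the closure of the rationals, which is required to be complete.\<close>

locale padic_closure =
  fixes p :: nat and absv :: "'k :: {alg_closed_field, field_char_0} \<Rightarrow> real"
  assumes prime: "prime p"
    and absv_nonneg: "absv x \<ge> 0"
    and absv_eq_0_iff: "absv x = 0 \<longleftrightarrow> x = 0"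
    and absv_mult: "absv (x * y) = absv x * absv y"
    and absv_add: "absv (x + y) \<le> max (absv x) (absv y)"
    and absv_of_rat: "absv (of_rat q) = padic_abs_rat p q"
    and complete:
      "(\<forall>i. u i \<in> rat_closure absv) \<Longrightarrow>
       (\<forall>\<epsilon>>0. \<exists>N. \<forall>i\<ge>N. \<forall>j\<ge>N. absv (u i - u j) < \<epsilon>) \<Longrightarrow>
       \<exists>l\<in>rat_closure absv. (\<lambda>i. absv (u i - l)) \<longlonglongrightarrow> 0"
    and algebraic:
      "\<exists>f. f \<noteq> 0 \<and> (\<forall>i. coeff f i \<in> rat_closure absv) \<and> poly f x = 0"

text \<open>\<open>|x|\<^sub>p = p\<close> to the power \<open>-ord\<^sub>p x\<close>, and \<open>ord\<^sub>p 0 = \<infinity>\<close>.\<close>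

definition padic_ord :: "nat \<Rightarrow> ('k :: field \<Rightarrow> real) \<Rightarrow> 'k \<Rightarrow> ereal" where
  "padic_ord p absv x = (if x = 0 then \<infinity> else ereal (- log (real p) (absv x)))"

text \<open>The residue field consists of the cosets of the maximal ideal in the valuation ring.\<close>

definition residue_class :: "('k :: field \<Rightarrow> real) \<Rightarrow> 'k \<Rightarrow> 'k set" where
  "residue_class absv x = {y. absv y \<le> 1 \<and> absv (y - x) < 1}"

definition teichmuller :: "nat \<Rightarrow> ('k :: field \<Rightarrow> real) \<Rightarrow> 'k set \<Rightarrow> 'k" where
  "teichmuller p absv c = (THE \<omega>. (\<exists>m>0. coprime m p \<and> \<omega> ^ m = 1) \<and> residue_class absv \<omega> = c)"

definition padic_mahler :: "('k :: field \<Rightarrow> real) \<Rightarrow> 'k poly \<Rightarrow> real" where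
  "padic_mahler absv g = absv (lead_coeff g) * (\<Prod>\<beta>\<in>#proots g. max 1 (absv \<beta>))"

definition log_padic_mahler :: "('k :: field \<Rightarrow> real) \<Rightarrow> 'k poly \<Rightarrow> real" where
  "log_padic_mahler absv g = ln (padic_mahler absv g)"

section \<open>The invariants\<close>

definition J_padic ::
    "('v, 'e) pregraph \<Rightarrow> 'v list \<Rightarrow> ('e \<Rightarrow> int) \<Rightarrow> 'k :: {alg_closed_field, field_char_0} poly" where
  "J_padic X vs \<alpha> = map_poly of_int (J_poly X vs \<alpha>)"

definition mu_inv ::
    "nat \<Rightarrow> ('k :: {alg_closed_field, field_char_0} \<Rightarrow> real) \<Rightarrow>
     ('v, 'e) pregraph \<Rightarrow> 'v list \<Rightarrow> ('e \<Rightarrow> int) \<Rightarrow> real" where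
  "mu_inv p absv X vs \<alpha> = - log_padic_mahler absv (J_padic X vs \<alpha>) / ln (real p)"

definition c_inv ::
    "nat \<Rightarrow> ('k :: {alg_closed_field, field_char_0} \<Rightarrow> real) \<Rightarrow>
     ('v, 'e) pregraph \<Rightarrow> 'v list \<Rightarrow> ('e \<Rightarrow> int) \<Rightarrow> ereal" where
  "c_inv p absv X vs \<alpha> = padic_ord p absv (of_nat (num_spanning_trees X))
     - padic_ord p absv (of_int (pierce_lehmer 1 (J_poly X vs \<alpha>)))"

definition B_set ::
    "('k :: {alg_closed_field, field_char_0} \<Rightarrow> real) \<Rightarrow>
     ('v, 'e) pregraph \<Rightarrow> 'v list \<Rightarrow> ('e \<Rightarrow> int) \<Rightarrow> nat \<Rightarrow> 'k set" where
  "B_set absv X vs \<alpha> n =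
     {\<beta>. poly (J_padic X vs \<alpha>) \<beta> = 0 \<and> absv \<beta> = 1 \<and> absv (\<beta> ^ n - 1) < 1}"

text \<open>The roots of \<open>J\<close> lying in \<open>B_set\<close>, counted with multiplicity.\<close>

definition B_roots ::
    "('k :: {alg_closed_field, field_char_0} \<Rightarrow> real) \<Rightarrow>
     ('v, 'e) pregraph \<Rightarrow> 'v list \<Rightarrow> ('e \<Rightarrow> int) \<Rightarrow> nat \<Rightarrow> 'k multiset" where
  "B_roots absv X vs \<alpha> n = {#\<beta> \<in># proots (J_padic X vs \<alpha>). \<beta> \<in> B_set absv X vs \<alpha> n#}"

definition lambda_inv ::
    "('k :: {alg_closed_field, field_char_0} \<Rightarrow> real) \<Rightarrow>
     ('v, 'e) pregraph \<Rightarrow> 'v list \<Rightarrow> ('e \<Rightarrow> int) \<Rightarrow> nat \<Rightarrow> int" where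
  "lambda_inv absv X vs \<alpha> n = int (size (B_roots absv X vs \<alpha> n)) + int (J_exp X vs \<alpha>) - 1"

definition s_inv :: "nat \<Rightarrow> ('k :: field \<Rightarrow> real) \<Rightarrow> 'k \<Rightarrow> nat" where
  "s_inv p absv \<beta> = (LEAST s. ereal (real p ^ s * (real p - 1)) *
     padic_ord p absv (\<beta> - teichmuller p absv (residue_class absv \<beta>)) > 1)"

definition r_inv :: "nat \<Rightarrow> ('k :: field \<Rightarrow> real) \<Rightarrow> nat \<Rightarrow> 'k \<Rightarrow> nat" where
  "r_inv p absv n \<beta> = min (multiplicity p n) (s_inv p absv \<beta>)"

definition nu_inv ::
    "nat \<Rightarrow> ('k :: {alg_closed_field, field_char_0} \<Rightarrow> real) \<Rightarrow>
     ('v, 'e) pregraph \<Rightarrow> 'v list \<Rightarrow> ('e \<Rightarrow> int) \<Rightarrow> nat \<Rightarrow> ereal" where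
  "nu_inv p absv X vs \<alpha> n =
     (\<Sum>\<beta>\<in>#B_roots absv X vs \<alpha> n.
        padic_ord p absv (\<beta> ^ (p ^ r_inv p absv n \<beta>)
          - teichmuller p absv (residue_class absv \<beta>) ^ (p ^ r_inv p absv n \<beta>))
        - ereal (real (r_inv p absv n \<beta>)))"

end

theory Submission
  imports Defs "Jordan_Normal_Form.Char_Poly"
begin

text \<open>Expanding \<open>det (s + L)\<close> row by row, where \<open>L\<close> is the Laplacian of a graph with \<open>g\<close> vertices, gives a
  sum over rooted spanning forests, weighted by \<open>s\<close> to the number of trees; so the coefficient of
  \<open>s\<close> is \<open>g \<kappa>\<close>. For the cyclic cover \<open>X\<^sub>n\<close> the characters of the cyclic group split this determinant into
  the product over \<open>\<zeta>\<^sup>n = 1\<close> of the determinants twisted by \<open>\<zeta>\<close>, and comparing coefficients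
  of \<open>s\<close> yields that \<open>n \<kappa>(X\<^sub>n)\<close> is \<open>\<kappa>(X)\<close> times the product of the Ihara polynomial over the \<open>\<zeta> \<noteq> 1\<close>.
  All of this takes place in the algebraic closure of the p-adic numbers. Up to units the product is
  \<open>n\<^sup>e \<Delta>\<^sub>n(J) / J(1)\<close>, and the valuation of a factor \<open>\<beta>\<^sup>n - 1\<close> of \<open>\<Delta>\<^sub>n(J)\<close> with \<open>\<beta>\<close> a unit near a root
  of unity \<open>\<tau>\<close> of order prime to \<open>p\<close> is found by comparing \<open>\<beta>\<^sup>n\<close> with \<open>\<tau>\<^sup>n\<close>: raising to a power
  prime to \<open>p\<close> preserves the distance of \<open>\<beta> / \<tau>\<close> to \<open>1\<close>, and raising to the power \<open>p\<close> divides it by exactly \<open>p\<close> once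
  it is below \<open>p\<close> to the power \<open>-1/(p-1)\<close>.\<close>

section \<open>Determinants indexed by finite sets\<close>

text \<open>The Leibniz formula over an arbitrary finite index set, so that vertex sets can index
  rows and columns without a chosen ordering.\<close>

definition setdet :: "'i set \<Rightarrow> ('i \<Rightarrow> 'i \<Rightarrow> 'a) \<Rightarrow> 'a :: comm_ring_1" where
  "setdet S M = (\<Sum>\<pi> | \<pi> permutes S. of_int (sign \<pi>) * (\<Prod>i\<in>S. M i (\<pi> i)))"

lemma setdet_cong:
  assumes "\<And>i j. i \<in> S \<Longrightarrow> j \<in> S \<Longrightarrow> M i j = N i j"
  shows "setdet S M = setdet S N"
  unfolding setdet_def
  by (intro sum.cong prod.cong arg_cong2[where f = "(*)"] refl)
     (use assms permutes_in_image in fastforce)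

lemma setdet_empty [simp]: "setdet {} M = 1"
  by (simp add: setdet_def)

lemma setdet_eq_det: "setdet {0..<n} M = det (mat n n (\<lambda>(i, j). M i j))"
  unfolding setdet_def det_def
  by (auto intro!: sum.cong prod.cong dest: permutes_in_image)

text \<open>Conjugation by \<open>h\<close> matches the permutations of the two sets and preserves
  their signs.\<close>

lemma setdet_reindex:
  assumes "bij_betw h S T" "finite S"
  shows "setdet T M = setdet S (\<lambda>i j. M (h i) (h j))"
proof -
  have inj: "inj_on h S" and T: "T = h ` S"
    using assms by (auto simp: bij_betw_def)
  have "setdet T M = (\<Sum>\<pi> | \<pi> permutes S. of_int (sign (map_permutation S h \<pi>)) *
      (\<Prod>i\<in>T. M i (map_permutation S h \<pi> i)))"
    unfolding setdet_def
  proof (rule sum.reindex_bij_betw[symmetric])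
    show "bij_betw (map_permutation S h) {\<pi>. \<pi> permutes S} {\<pi>. \<pi> permutes T}"
      using bij_betw_permutations[OF assms(1)]
      by (rule bij_betw_cong[THEN iffD1, rotated])
         (auto simp: map_permutation_def restrict_id_def T fun_eq_iff)
  qed
  also have "\<dots> = setdet S (\<lambda>i j. M (h i) (h j))"
    unfolding setdet_def
  proof (rule sum.cong[OF refl])
    fix \<pi> assume "\<pi> \<in> {\<pi>. \<pi> permutes S}"
    then have \<pi>: "\<pi> permutes S" by simp
    have "(\<Prod>i\<in>T. M i (map_permutation S h \<pi> i)) = (\<Prod>i\<in>S. M (h i) (h (\<pi> i)))"
      unfolding T prod.reindex[OF inj]
      by (rule prod.cong) (auto simp: map_permutation_apply inj)
    then show "of_int (sign (map_permutation S h \<pi>)) * (\<Prod>i\<in>T. M i (map_permutation S h \<pi> i)) =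
        of_int (sign \<pi>) * (\<Prod>i\<in>S. M (h i) (h (\<pi> i)))"
      using sign_map_permutation[OF inj \<pi> assms(2)] by simp
  qed
  finally show ?thesis .
qed

text \<open>An enumeration of \<open>S\<close> turns \<open>setdet\<close> into a determinant of
  matrices, which is how multiplicativity, kernels and block decompositions carry over.\<close>

lemma setdet_eq_det_enum:
  assumes "bij_betw h {0..<n} S"
  shows "setdet S M = det (mat n n (\<lambda>(i, j). M (h i) (h j)))"
  using setdet_reindex[OF assms] by (simp add: setdet_eq_det)

lemma setdet_mult:
  assumes "finite S"
  shows "setdet S (\<lambda>i k. \<Sum>j\<in>S. M i j * N j k) = setdet S M * setdet S N"
proof -
  obtain h where h: "bij_betw h {0..<card S} S"
    using ex_bij_betw_nat_finite[OF assms] by blast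
  let ?A = "\<lambda>M. mat (card S) (card S) (\<lambda>(i, j). M (h i) (h j))"
  have "?A (\<lambda>i k. \<Sum>j\<in>S. M i j * N j k) = ?A M * ?A N"
    by (rule eq_matI)
       (auto simp: scalar_prod_def sum.reindex_bij_betw[OF h, symmetric])
  then show ?thesis
    unfolding setdet_eq_det_enum[OF h] by (simp add: det_mult[of _ "card S"])
qed

text \<open>This disposes of the choice functions with a cycle, for which an explicit kernel vector
  is at hand.\<close>

lemma setdet_eq_0_if_kernel:
  fixes M :: "'i \<Rightarrow> 'i \<Rightarrow> 'a :: idom"
  assumes "finite S" "i \<in> S" "x i \<noteq> 0" "\<And>i. i \<in> S \<Longrightarrow> (\<Sum>j\<in>S. M i j * x j) = 0"
  shows "setdet S M = 0"
proof -
  obtain h where h: "bij_betw h {0..<card S} S"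
    using ex_bij_betw_nat_finite[OF assms(1)] by blast
  let ?A = "mat (card S) (card S) (\<lambda>(i, j). M (h i) (h j))"
  let ?v = "vec (card S) (x \<circ> h)"
  obtain k where k: "k < card S" "h k = i"
    using h assms(2) by (force simp: bij_betw_def)
  have "?v $ k \<noteq> 0\<^sub>v (card S) $ k"
    using k assms(3) by simp
  then have "?v \<noteq> 0\<^sub>v (card S)"
    by metis
  moreover have "?A *\<^sub>v ?v = 0\<^sub>v (card S)"
  proof (rule eq_vecI)
    fix i assume "i < dim_vec (0\<^sub>v (card S) :: 'a vec)"
    then have i: "i < card S" by simp
    then have "h i \<in> S" using h by (auto simp: bij_betw_def)
    then have "(\<Sum>j\<in>{0..<card S}. M (h i) (h j) * x (h j)) = 0"
      using assms(4) sum.reindex_bij_betw[OF h, of "\<lambda>j. M (h i) j * x j"] by simp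
    with i show "(?A *\<^sub>v ?v) $ i = 0\<^sub>v (card S) $ i"
      by (simp add: scalar_prod_def)
  qed simp
  ultimately show ?thesis
    unfolding setdet_eq_det_enum[OF h]
    by (subst det_0_iff_vec_prod_zero[of _ "card S"]) (auto intro: exI[of _ ?v])
qed

text \<open>Multilinearity in the rows: distributing the product over \<open>i\<close> leaves one
  term for each way of picking a summand \<open>f i\<close> in every row.\<close>

lemma setdet_rows_sum:
  assumes "finite S" "\<And>i. i \<in> S \<Longrightarrow> finite (C i)"
  shows "setdet S (\<lambda>i j. \<Sum>c\<in>C i. w i c j) = (\<Sum>f\<in>PiE S C. setdet S (\<lambda>i j. w i (f i) j))"
  unfolding setdet_def using assms
  by (simp add: prod_sum_PiE sum_distrib_left sum.swap[of _ "{\<pi>. \<pi> permutes S}"])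

text \<open>A permutation with a nonzero term strictly lowers \<open>d\<close> at each moved point
  and keeps it elsewhere, whereas the sum of \<open>d\<close> over \<open>S\<close> is invariant
  under permutation; so only the identity contributes.\<close>

lemma setdet_triangular:
  fixes d :: "'i \<Rightarrow> nat"
  assumes "finite S"
    and tri: "\<And>i j. i \<in> S \<Longrightarrow> j \<in> S \<Longrightarrow> i \<noteq> j \<Longrightarrow> M i j \<noteq> 0 \<Longrightarrow> d j < d i"
  shows "setdet S M = (\<Prod>i\<in>S. M i i)"
proof -
  have zero: "(\<Prod>i\<in>S. M i (\<pi> i)) = 0" if \<pi>: "\<pi> permutes S" and "\<pi> \<noteq> id" for \<pi>
  proof (rule ccontr)
    assume "(\<Prod>i\<in>S. M i (\<pi> i)) \<noteq> 0"
    then have nz: "M i (\<pi> i) \<noteq> 0" if "i \<in> S" for i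
      using that assms(1) prod_zero by metis
    have less: "d (\<pi> i) < d i" if "i \<in> S" "\<pi> i \<noteq> i" for i
      using tri[of i "\<pi> i"] nz that permutes_in_image[OF \<pi>] by metis
    from \<open>\<pi> \<noteq> id\<close> obtain i where i: "\<pi> i \<noteq> i" by (auto simp: fun_eq_iff)
    then have "i \<in> S" using \<pi> permutes_not_in by metis
    have "(\<Sum>i\<in>S. d (\<pi> i)) < (\<Sum>i\<in>S. d i)"
    proof (rule sum_strict_mono_ex1[OF assms(1)])
      show "\<forall>i\<in>S. d (\<pi> i) \<le> d i" using less by (metis less_imp_le order_refl)
      show "\<exists>i\<in>S. d (\<pi> i) < d i" using less i \<open>i \<in> S\<close> by blast
    qed
    moreover have "(\<Sum>i\<in>S. d (\<pi> i)) = (\<Sum>i\<in>S. d i)"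
      using sum.permute[OF \<pi>, of d] by (simp add: o_def)
    ultimately show False by simp
  qed
  have "setdet S M = (\<Sum>\<pi>\<in>{id}. of_int (sign \<pi>) * (\<Prod>i\<in>S. M i (\<pi> i)))"
    unfolding setdet_def using assms(1) zero
    by (intro sum.mono_neutral_right) (auto simp: finite_permutations permutes_id)
  then show ?thesis by simp
qed

text \<open>Listing \<open>A\<close> before \<open>B\<close> gives a matrix with vanishing lower
  left block.\<close>

lemma setdet_block_triangular:
  fixes M :: "'i \<Rightarrow> 'i \<Rightarrow> 'a :: idom"
  assumes "finite A" "finite B" "A \<inter> B = {}" "\<And>i j. i \<in> B \<Longrightarrow> j \<in> A \<Longrightarrow> M i j = 0"
  shows "setdet (A \<union> B) M = setdet A M * setdet B M"
proof -
  let ?a = "card A" and ?b = "card B"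
  obtain h where h: "bij_betw h {0..<?a} A"
    using ex_bij_betw_nat_finite[OF assms(1)] by blast
  obtain k where k: "bij_betw k {0..<?b} B"
    using ex_bij_betw_nat_finite[OF assms(2)] by blast
  define l where "l i = (if i < ?a then h i else k (i - ?a))" for i
  have "bij_betw l ({0..<?a} \<union> {?a..<?a + ?b}) (A \<union> B)"
  proof (rule bij_betw_combine[OF _ _ assms(3)])
    show "bij_betw l {0..<?a} A"
      using h by (rule bij_betw_cong[THEN iffD1, rotated]) (auto simp: l_def)
    have "bij_betw (k \<circ> (\<lambda>i. i - ?a)) {?a..<?a + ?b} B"
      by (rule bij_betw_trans[OF _ k], rule bij_betw_byWitness[where f' = "\<lambda>i. i + ?a"]) auto
    then show "bij_betw l {?a..<?a + ?b} B"
      by (rule bij_betw_cong[THEN iffD1, rotated]) (auto simp: l_def)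
  qed
  also have "{0..<?a} \<union> {?a..<?a + ?b} = {0..<?a + ?b}"
    by auto
  finally have l: "bij_betw l {0..<?a + ?b} (A \<union> B)" .
  have in_sets: "h i \<in> A" if "i < ?a" for i using h that by (auto simp: bij_betw_def)
  have in_sets': "k i \<in> B" if "i < ?b" for i using k that by (auto simp: bij_betw_def)
  let ?A2 = "mat ?a ?b (\<lambda>(i, j). M (h i) (k j))"
  have "mat (?a + ?b) (?a + ?b) (\<lambda>(i, j). M (l i) (l j)) =
      four_block_mat (mat ?a ?a (\<lambda>(i, j). M (h i) (h j))) ?A2 (0\<^sub>m ?b ?a)
        (mat ?b ?b (\<lambda>(i, j). M (k i) (k j)))"
    by (rule eq_matI) (auto simp: l_def in_sets in_sets' assms(4))
  then show ?thesis
    unfolding setdet_eq_det_enum[OF l] setdet_eq_det_enum[OF h] setdet_eq_det_enum[OF k]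
    by (simp add: det_four_block_mat_lower_left_zero[of _ ?a _ ?b])
qed

lemma setdet_block_diagonal:
  fixes M :: "'b \<Rightarrow> 'i \<Rightarrow> 'i \<Rightarrow> 'a :: idom"
  assumes "finite S" "finite T"
  shows "setdet (S \<times> T) (\<lambda>(i, b) (j, c). if b = c then M b i j else 0) = (\<Prod>b\<in>T. setdet S (M b))"
  using assms(2)
proof (induction T rule: finite_induct)
  case (insert t T)
  let ?M = "\<lambda>(i, b) (j, c). if b = c then M b i j else 0"
  have "setdet (S \<times> {t} \<union> S \<times> T) ?M = setdet (S \<times> {t}) ?M * setdet (S \<times> T) ?M"
    using assms(1) insert.hyps by (intro setdet_block_triangular) auto
  moreover have "S \<times> insert t T = S \<times> {t} \<union> S \<times> T" by auto
  moreover have "bij_betw (\<lambda>i. (i, t)) S (S \<times> {t})"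
    by (auto simp: bij_betw_def inj_on_def)
  from setdet_reindex[OF this assms(1), of ?M]
  have "setdet (S \<times> {t}) ?M = setdet S (M t)" by simp
  ultimately show ?case
    using insert by simp
qed simp

section \<open>The matrix-tree theorem\<close>

text \<open>This is \<open>s + L\<close> with edge \<open>e\<close> weighted by \<open>x e\<close>.
  Counting the degree edge by edge makes every row a sum over outgoing edges. Weight 1 gives the
  ordinary Laplacian; \<open>s = 0\<close> with weights \<open>z powi \<alpha> e\<close> gives the
  Ihara matrix at \<open>z\<close>.\<close>

definition laplacian ::
    "('v, 'e) pregraph \<Rightarrow> 'a \<Rightarrow> ('e \<Rightarrow> 'a) \<Rightarrow> 'v \<Rightarrow> 'v \<Rightarrow> 'a :: comm_ring_1" where
  "laplacian Y s x u v = (if u = v then s else 0) +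
     (\<Sum>e | e \<in> edges Y \<and> origin Y e = u.
        (if u = v then 1 else 0) - (if terminus Y e = v then x e else 0))"

text \<open>A choice function selects at each vertex either an outgoing edge, or nothing, in which case
  the vertex is called a root.\<close>

definition choices :: "('v, 'e) pregraph \<Rightarrow> 'v \<Rightarrow> 'e option set" where
  "choices Y v = insert None (Some ` {e \<in> edges Y. origin Y e = v})"

definition choice_row :: "('v, 'e) pregraph \<Rightarrow> 'a \<Rightarrow> 'v \<Rightarrow> 'e option \<Rightarrow> 'v \<Rightarrow> 'a :: comm_ring_1" where
  "choice_row Y s v c u = (case c of None \<Rightarrow> if v = u then s else 0
     | Some e \<Rightarrow> (if v = u then 1 else 0) - (if terminus Y e = u then 1 else 0))"

text \<open>Acyclicity in the form of a height function that drops along every chosen edge; the same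
  function certifies triangularity in \<open>setdet_triangular\<close>.\<close>

definition ranked :: "('v, 'e) pregraph \<Rightarrow> ('v \<Rightarrow> 'e option) \<Rightarrow> ('v \<Rightarrow> nat) \<Rightarrow> bool" where
  "ranked Y f d \<longleftrightarrow> (\<forall>v\<in>verts Y. \<forall>e. f v = Some e \<longrightarrow> d (terminus Y e) < d v)"

definition roots :: "('v, 'e) pregraph \<Rightarrow> ('v \<Rightarrow> 'e option) \<Rightarrow> 'v set" where
  "roots Y f = {v \<in> verts Y. f v = None}"

definition forests :: "('v, 'e) pregraph \<Rightarrow> ('v \<Rightarrow> 'e option) set" where
  "forests Y = {f \<in> PiE (verts Y) (choices Y). \<exists>d. ranked Y f d}"

definition chosen_arcs :: "('v, 'e) pregraph \<Rightarrow> ('v \<Rightarrow> 'e option) \<Rightarrow> ('v \<times> 'v) set" where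
  "chosen_arcs Y f = {(v, terminus Y e) |v e. v \<in> verts Y \<and> f v = Some e}"

definition reaches_root :: "('v, 'e) pregraph \<Rightarrow> ('v \<Rightarrow> 'e option) \<Rightarrow> 'v \<Rightarrow> bool" where
  "reaches_root Y f v \<longleftrightarrow> (\<exists>r. (v, r) \<in> (chosen_arcs Y f)\<^sup>* \<and> f r = None)"

definition chosen_edges :: "('v, 'e) pregraph \<Rightarrow> ('v \<Rightarrow> 'e option) \<Rightarrow> 'e set" where
  "chosen_edges Y f = (let F = {e. \<exists>v\<in>verts Y. f v = Some e} in F \<union> inversion Y ` F)"

abbreviation adj :: "('v, 'e) pregraph \<Rightarrow> 'e set \<Rightarrow> ('v \<times> 'v) set" where
  "adj Y T \<equiv> {(origin Y e, terminus Y e) |e. e \<in> T}"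

lemma reaches_root_None: "f v = None \<Longrightarrow> reaches_root Y f v"
  unfolding reaches_root_def by blast

lemma reaches_root_Some:
  assumes "v \<in> verts Y" "f v = Some e"
  shows "reaches_root Y f v \<longleftrightarrow> reaches_root Y f (terminus Y e)"
proof -
  have *: "(v, w) \<in> chosen_arcs Y f \<longleftrightarrow> w = terminus Y e" for w
    using assms by (auto simp: chosen_arcs_def)
  show ?thesis
    unfolding reaches_root_def
    using assms(2) * by (metis converse_rtranclE converse_rtrancl_into_rtrancl option.distinct(1))
qed

text \<open>The number of steps to a root is a rank: a vertex has only one chosen arc, so every
  shortest path to a root starts with it.\<close>

lemma ranked_if_reaches_root:
  assumes "\<And>v. v \<in> verts Y \<Longrightarrow> reaches_root Y f v"
  shows "\<exists>d. ranked Y f d"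
proof -
  let ?R = "chosen_arcs Y f"
  define d where "d v = (LEAST k. \<exists>r. (v, r) \<in> ?R ^^ k \<and> f r = None)" for v
  have "d (terminus Y e) < d v" if v: "v \<in> verts Y" and e: "f v = Some e" for v e
  proof -
    have "\<exists>k. \<exists>r. (v, r) \<in> ?R ^^ k \<and> f r = None"
      using assms[OF v] unfolding reaches_root_def rtrancl_power by blast
    then have "\<exists>r. (v, r) \<in> ?R ^^ d v \<and> f r = None"
      unfolding d_def by (rule LeastI_ex[where P = "\<lambda>k. \<exists>r. (v, r) \<in> ?R ^^ k \<and> f r = None"])
    then obtain r where r: "(v, r) \<in> ?R ^^ d v" "f r = None" by blast
    have "d v \<noteq> 0"
      using r e by (metis option.distinct(1) relpow_0_E)
    then obtain k where k: "d v = Suc k"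
      using not0_implies_Suc by blast
    then obtain w where "(v, w) \<in> ?R" "(w, r) \<in> ?R ^^ k"
      using r(1) by (metis relpow_Suc_D2)
    then have "(terminus Y e, r) \<in> ?R ^^ k"
      using e by (auto simp: chosen_arcs_def)
    then have "d (terminus Y e) \<le> k"
      unfolding d_def using r(2)
      by (intro Least_le[where P = "\<lambda>k. \<exists>r. (terminus Y e, r) \<in> ?R ^^ k \<and> f r = None"]) blast
    with k show ?thesis by simp
  qed
  then show ?thesis unfolding ranked_def by blast
qed

locale finite_serre_graph =
  fixes Y :: "('v, 'e) pregraph"
  assumes serre: "serre_graph Y" and finite: "finite_graph Y"
begin

lemma finite_verts [simp]: "finite (verts Y)" and finite_edges [simp]: "finite (edges Y)"
  using finite by (auto simp: finite_graph_def)

lemma edge [simp]: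
  assumes "e \<in> edges Y"
  shows "origin Y e \<in> verts Y" "terminus Y e \<in> verts Y" "inversion Y e \<in> edges Y"
    "origin Y (inversion Y e) = terminus Y e" "terminus Y (inversion Y e) = origin Y e"
    "inversion Y (inversion Y e) = e" "inversion Y e \<noteq> e"
  using serre assms by (auto simp: serre_graph_def)

lemma finite_choices [simp]: "finite (choices Y v)"
  by (simp add: choices_def)

lemma choiceD:
  assumes "f \<in> PiE (verts Y) (choices Y)" "v \<in> verts Y" "f v = Some e"
  shows "e \<in> edges Y" "origin Y e = v"
proof -
  from assms have "Some e \<in> choices Y v"
    by (metis PiE_mem)
  then show "e \<in> edges Y" "origin Y e = v"
    by (auto simp: choices_def)
qed

lemma finite_forests: "finite (forests Y)"
  unfolding forests_def by (simp add: finite_PiE)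

lemma laplacian_eq_sum_choices:
  "laplacian Y s (\<lambda>_. 1) v u = (\<Sum>c\<in>choices Y v. choice_row Y s v c u)"
proof -
  have "(\<Sum>c\<in>choices Y v. choice_row Y s v c u) = choice_row Y s v None u +
      (\<Sum>c\<in>Some ` {e \<in> edges Y. origin Y e = v}. choice_row Y s v c u)"
    unfolding choices_def by (subst sum.insert) auto
  then show ?thesis
    by (simp add: laplacian_def choice_row_def sum.reindex)
qed

text \<open>For an acyclic choice the matrix is triangular along the rank, with diagonal entry
  \<open>s\<close> at a root and 1 elsewhere, because a chosen edge is never a loop. Otherwise some
  vertex never reaches a root and the matrix is singular.\<close>

lemma setdet_choice_rows:
  fixes s :: "'a :: idom"
  assumes f: "f \<in> PiE (verts Y) (choices Y)"
  shows "setdet (verts Y) (\<lambda>v u. choice_row Y s v (f v) u) =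
    (if \<exists>d. ranked Y f d then s ^ card (roots Y f) else 0)"
proof (cases "\<exists>d. ranked Y f d")
  case True
  then obtain d where d: "ranked Y f d" by blast
  have "setdet (verts Y) (\<lambda>v u. choice_row Y s v (f v) u) =
      (\<Prod>v\<in>verts Y. choice_row Y s v (f v) v)"
    by (rule setdet_triangular[where d = d])
       (use d in \<open>auto simp: choice_row_def ranked_def split: option.splits if_splits\<close>)
  also have "\<dots> = (\<Prod>v\<in>verts Y. if f v = None then s else 1)"
    by (intro prod.cong)
       (use d in \<open>auto simp: choice_row_def ranked_def split: option.splits\<close>)
  also have "\<dots> = s ^ card (roots Y f)"
    by (simp add: prod.If_cases roots_def Int_def)
  finally show ?thesis using True by simp
next
  case False
  then obtain i where i: "i \<in> verts Y" "\<not> reaches_root Y f i"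
    using ranked_if_reaches_root[of Y f] by metis
  \<comment> \<open>Indicator of the vertices that reach no root. It is zero at roots and constant
    along chosen edges, so every row kills it.\<close>
  define x where "x v = (if reaches_root Y f v then 0 else 1 :: 'a)" for v
  have "setdet (verts Y) (\<lambda>v u. choice_row Y s v (f v) u) = 0"
  proof (rule setdet_eq_0_if_kernel[where x = x])
    fix v assume v: "v \<in> verts Y"
    show "(\<Sum>u\<in>verts Y. choice_row Y s v (f v) u * x u) = 0"
    proof (cases "f v")
      case None
      then have "choice_row Y s v (f v) u * x u = 0" for u
        using reaches_root_None[of f v Y] by (auto simp: choice_row_def x_def)
      then show ?thesis by (intro sum.neutral) blast
    next
      case (Some e)
      have "(\<Sum>u\<in>verts Y. choice_row Y s v (f v) u * x u) =
          (\<Sum>u\<in>verts Y. (if v = u then x u else 0) - (if terminus Y e = u then x u else 0))"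
        by (intro sum.cong) (auto simp: choice_row_def Some)
      also have "\<dots> = x v - x (terminus Y e)"
        using v choiceD[OF f v Some] by (simp add: sum_subtractf)
      also have "\<dots> = 0"
        using reaches_root_Some[of v Y f e] v Some by (simp add: x_def)
      finally show ?thesis .
    qed
  qed (use i in \<open>auto simp: x_def\<close>)
  with False show ?thesis by simp
qed

text \<open>Expanding by rows gives one determinant per choice function, and only the acyclic ones
  survive.\<close>

lemma setdet_laplacian:
  fixes s :: "'a :: idom"
  shows "setdet (verts Y) (laplacian Y s (\<lambda>_. 1)) = (\<Sum>f\<in>forests Y. s ^ card (roots Y f))"
proof -
  have "setdet (verts Y) (laplacian Y s (\<lambda>_. 1)) =
      (\<Sum>f\<in>PiE (verts Y) (choices Y). if \<exists>d. ranked Y f d then s ^ card (roots Y f) else 0)"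
    unfolding laplacian_eq_sum_choices
    by (subst setdet_rows_sum) (auto intro!: sum.cong setdet_choice_rows)
  then show ?thesis
    by (simp add: forests_def sum.inter_filter finite_PiE)
qed

text \<open>A vertex of least rank cannot have a chosen edge.\<close>

lemma roots_nonempty:
  assumes "f \<in> forests Y" "verts Y \<noteq> {}"
  shows "roots Y f \<noteq> {}"
proof -
  obtain d where d: "ranked Y f d" and f: "f \<in> PiE (verts Y) (choices Y)"
    using assms by (auto simp: forests_def)
  obtain u where "u \<in> verts Y" using assms(2) by blast
  from ex_has_least_nat[of "\<lambda>v. v \<in> verts Y", OF this, of d]
  obtain v where v: "v \<in> verts Y" "\<And>w. w \<in> verts Y \<Longrightarrow> d v \<le> d w"
    by blast
  have "f v = None"
  proof (rule ccontr)
    assume "f v \<noteq> None"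
    then obtain e where e: "f v = Some e" by blast
    with d v have "d (terminus Y e) < d v" by (auto simp: ranked_def)
    with v(2) choiceD[OF f v(1) e] show False by (metis edge(2) leD)
  qed
  with v show ?thesis by (auto simp: roots_def)
qed

section \<open>Forests with a single root and spanning trees\<close>

lemma sym_adj:
  assumes "T \<subseteq> edges Y" "inversion Y ` T \<subseteq> T"
  shows "sym (adj Y T)"
proof (rule symI)
  fix u v assume "(u, v) \<in> adj Y T"
  then obtain e where "e \<in> T" "u = origin Y e" "v = terminus Y e" by blast
  then show "(v, u) \<in> adj Y T"
    using assms by (auto intro!: exI[of _ "inversion Y e"])
qed

lemma chosen_edges_subset:
  assumes "f \<in> PiE (verts Y) (choices Y)"
  shows "chosen_edges Y f \<subseteq> edges Y" "inversion Y ` chosen_edges Y f \<subseteq> chosen_edges Y f"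
  using choiceD[OF assms] by (auto simp: chosen_edges_def Let_def)

lemma chosen_edges_cases:
  assumes "f \<in> PiE (verts Y) (choices Y)" "e \<in> chosen_edges Y f"
  obtains "f (origin Y e) = Some e" | "f (terminus Y e) = Some (inversion Y e)"
  using assms choiceD[OF assms(1)] by (auto simp: chosen_edges_def Let_def)

text \<open>By induction on the rank, chosen edges lead from every vertex to \<open>r\<close>; their
  inverses give the paths back.\<close>

lemma connected_chosen_edges:
  assumes f: "f \<in> forests Y" and r: "roots Y f = {r}"
  shows "connected_graph (Y\<lparr>edges := chosen_edges Y f\<rparr>)"
proof -
  let ?A = "adj Y (chosen_edges Y f)"
  obtain d where d: "ranked Y f d" and f': "f \<in> PiE (verts Y) (choices Y)"
    using f by (auto simp: forests_def)
  have reach: "(v, r) \<in> ?A\<^sup>*" if "v \<in> verts Y" for v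
    using that
  proof (induction "d v" arbitrary: v rule: less_induct)
    case less
    show ?case
    proof (cases "f v")
      case None
      with less.prems r have "v = r" by (auto simp: roots_def)
      then show ?thesis by simp
    next
      case (Some e)
      have "d (terminus Y e) < d v" using d less.prems Some by (auto simp: ranked_def)
      moreover have e: "e \<in> edges Y" "origin Y e = v" using choiceD[OF f' less.prems Some] .
      ultimately have "(terminus Y e, r) \<in> ?A\<^sup>*" using less.hyps by simp
      moreover have "(v, terminus Y e) \<in> ?A"
        using Some less.prems e by (auto simp: chosen_edges_def Let_def)
      ultimately show ?thesis by (rule converse_rtrancl_into_rtrancl[rotated])
    qed
  qed
  have "sym (?A\<^sup>*)"
    by (intro sym_rtrancl sym_adj chosen_edges_subset[OF f'])
  then show ?thesis
    unfolding connected_graph_def using reach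
    by simp (meson rtrancl_trans symD)
qed

text \<open>Consider a vertex of maximal rank on the circuit. The circuit edge leaving it and the
  inverse of the one entering it must both be the edge chosen there, since an edge chosen at its
  other end would start at a higher rank. The circuit then backtracks.\<close>

lemma no_circuit_chosen_edges:
  assumes f: "f \<in> forests Y"
  shows "\<not> circuit (Y\<lparr>edges := chosen_edges Y f\<rparr>) es"
proof
  assume circ: "circuit (Y\<lparr>edges := chosen_edges Y f\<rparr>) es"
  obtain d where d: "ranked Y f d" and f': "f \<in> PiE (verts Y) (choices Y)"
    using f by (auto simp: forests_def)
  let ?n = "length es"
  have pos: "?n > 0" and sub: "set es \<subseteq> chosen_edges Y f"
    and next_edge: "\<And>i. i < ?n \<Longrightarrow> terminus Y (es ! i) = origin Y (es ! (Suc i mod ?n)) \<and>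
      es ! (Suc i mod ?n) \<noteq> inversion Y (es ! i)"
    using circ by (auto simp: circuit_def Let_def)
  let ?D = "(\<lambda>i. d (origin Y (es ! i))) ` {..<?n}"
  have "Max ?D \<in> ?D"
    using pos by (intro Max_in) auto
  then obtain i where "i < ?n" and max: "Max ?D = d (origin Y (es ! i))"
    by blast
  moreover have "d (origin Y (es ! j)) \<le> Max ?D" if "j < ?n" for j
    using that by (intro Max_ge) auto
  ultimately have i: "i < ?n" "\<And>j. j < ?n \<Longrightarrow> d (origin Y (es ! j)) \<le> d (origin Y (es ! i))"
    by auto
  \<comment> \<open>The cyclic predecessor of \<open>i\<close>, so that \<open>es ! j\<close> ends
    where \<open>es ! i\<close> starts.\<close>
  define j where "j = (if i = 0 then ?n - 1 else i - 1)"
  have j: "j < ?n" "Suc j mod ?n = i"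
    using i(1) pos by (auto simp: j_def)
  have in_chosen: "es ! k \<in> chosen_edges Y f" if "k < ?n" for k
    using that sub nth_mem by blast
  have in_edges: "es ! k \<in> edges Y" if "k < ?n" for k
    using in_chosen[OF that] chosen_edges_subset[OF f'] by blast
  have less: "d (terminus Y e) < d (origin Y e)" if "e \<in> edges Y" "f (origin Y e) = Some e" for e
    using d that by (auto simp: ranked_def)
  have *: "f (origin Y (es ! i)) = Some (es ! i)"
    using f' in_chosen[OF i(1)]
  proof (cases rule: chosen_edges_cases)
    case 2
    from less[of "inversion Y (es ! i)"] 2 have "d (origin Y (es ! i)) < d (terminus Y (es ! i))"
      using in_edges[OF i(1)] by simp
    then show ?thesis
      using next_edge[OF i(1)] i(2)[of "Suc i mod ?n"] pos by simp
  qed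
  from f' in_chosen[OF j(1)] show False
  proof (cases rule: chosen_edges_cases)
    case 1
    then show ?thesis
      using less[OF in_edges[OF j(1)]] next_edge[OF j(1)] i(2)[OF j(1)] j(2) by simp
  next
    case 2
    then have "es ! i = inversion Y (es ! j)"
      using * next_edge[OF j(1)] j(2) by simp
    then show ?thesis
      using next_edge[OF j(1)] j(2) by simp
  qed
qed

lemma chosen_edges_spanning_tree:
  assumes "f \<in> forests Y" "roots Y f = {r}"
  shows "chosen_edges Y f \<in> spanning_trees Y"
proof -
  have "f \<in> PiE (verts Y) (choices Y)" using assms by (auto simp: forests_def)
  moreover have "verts Y \<noteq> {}" using assms by (auto simp: roots_def)
  ultimately show ?thesis
    using connected_chosen_edges[OF assms] no_circuit_chosen_edges[OF assms(1)] chosen_edges_subset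
    by (simp add: spanning_trees_def tree_def)
qed

text \<open>Induction on the rank of \<open>f\<close>. If the edge chosen by \<open>f\<close> at
  \<open>v\<close> were used by \<open>g\<close> in the opposite direction, then \<open>f\<close>
  would choose that opposite edge too, by the induction hypothesis at the lower end, and the rank
  would drop both ways.\<close>

lemma inj_chosen_edges:
  assumes f: "f \<in> forests Y" "roots Y f = {r}" and g: "g \<in> forests Y" "roots Y g = {r}"
    and eq: "chosen_edges Y f = chosen_edges Y g"
  shows "f = g"
proof -
  obtain d where d: "ranked Y f d" and f': "f \<in> PiE (verts Y) (choices Y)"
    using f by (auto simp: forests_def)
  have g': "g \<in> PiE (verts Y) (choices Y)"
    using g by (auto simp: forests_def)
  have "f v = g v" if "v \<in> verts Y" for v
    using that
  proof (induction "d v" arbitrary: v rule: less_induct)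
    case less
    show ?case
    proof (cases "f v")
      case None
      with less.prems f(2) g(2) have "v \<in> roots Y g" by (auto simp: roots_def)
      with None show ?thesis by (simp add: roots_def)
    next
      case (Some e)
      have e: "e \<in> edges Y" "origin Y e = v" using choiceD[OF f' less.prems Some] .
      have "d (terminus Y e) < d v" using d less.prems Some by (auto simp: ranked_def)
      have "e \<in> chosen_edges Y g"
        using Some less.prems eq by (auto simp: chosen_edges_def Let_def)
      with g' show ?thesis
      proof (cases rule: chosen_edges_cases)
        case 2
        then have "f (terminus Y e) = Some (inversion Y e)"
          using less.hyps[OF \<open>d (terminus Y e) < d v\<close>] e by simp
        then have "d v < d (terminus Y e)"
          using d e unfolding ranked_def by (metis edge(2) edge(5))
        with \<open>d (terminus Y e) < d v\<close> show ?thesis by simp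
      qed (use Some e in simp)
    qed
  qed
  then show ?thesis
    using f' g' by (metis PiE_ext)
qed

text \<open>Breadth-first search: every vertex chooses an edge that decreases the distance to the root.\<close>

lemma forest_exists:
  assumes T: "T \<subseteq> edges Y" "connected_graph (Y\<lparr>edges := T\<rparr>)" and r: "r \<in> verts Y"
  shows "\<exists>f\<in>forests Y. roots Y f = {r} \<and> (\<forall>v\<in>verts Y. \<forall>e. f v = Some e \<longrightarrow> e \<in> T)"
proof -
  define d where "d v = (LEAST k. (v, r) \<in> adj Y T ^^ k)" for v
  have step: "\<exists>e\<in>T. origin Y e = v \<and> d (terminus Y e) < d v" if v: "v \<in> verts Y" "v \<noteq> r" for v
  proof -
    have "(v, r) \<in> (adj Y T)\<^sup>*"
      using T(2) v r by (simp add: connected_graph_def)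
    then have "\<exists>k. (v, r) \<in> adj Y T ^^ k"
      by (simp add: rtrancl_power)
    then have dv: "(v, r) \<in> adj Y T ^^ d v"
      unfolding d_def by (rule LeastI_ex[where P = "\<lambda>k. (v, r) \<in> adj Y T ^^ k"])
    have "d v \<noteq> 0"
      using dv v(2) by (intro notI) simp
    then obtain k where k: "d v = Suc k"
      using not0_implies_Suc by blast
    then obtain w where w: "(v, w) \<in> adj Y T" "(w, r) \<in> adj Y T ^^ k"
      using relpow_Suc_D2[of v r k "adj Y T"] dv unfolding k by blast
    have "d w \<le> k"
      unfolding d_def using w(2) by (rule Least_le[where P = "\<lambda>k. (w, r) \<in> adj Y T ^^ k"])
    with w(1) k show ?thesis by auto
  qed
  then obtain c where c: "\<And>v. v \<in> verts Y \<Longrightarrow> v \<noteq> r \<Longrightarrow>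
      c v \<in> T \<and> origin Y (c v) = v \<and> d (terminus Y (c v)) < d v"
    by metis
  define f where "f = (\<lambda>v\<in>verts Y. if v = r then None else Some (c v))"
  have "c v \<in> edges Y" if "v \<in> verts Y" "v \<noteq> r" for v
    using c[OF that] T(1) by blast
  with c have "f \<in> forests Y"
    unfolding forests_def ranked_def
    by (auto simp: f_def choices_def intro!: exI[of _ d])
  moreover have "roots Y f = {r}"
    using r by (auto simp: roots_def f_def)
  moreover have "\<forall>v\<in>verts Y. \<forall>e. f v = Some e \<longrightarrow> e \<in> T"
    using c by (auto simp: f_def)
  ultimately show ?thesis by blast
qed

text \<open>A shortest path is simple, since between two visits to the same vertex it could be
  cut.\<close>

lemma simple_path:
  assumes "(u, v) \<in> R\<^sup>*"
  obtains g k where "g 0 = u" "g k = v" "\<And>i. i < k \<Longrightarrow> (g i, g (Suc i)) \<in> R" "inj_on g {..k :: nat}"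
proof -
  define k where "k = (LEAST k. (u, v) \<in> R ^^ k)"
  have "\<exists>k. (u, v) \<in> R ^^ k"
    using assms by (simp add: rtrancl_power)
  then have "(u, v) \<in> R ^^ k"
    unfolding k_def by (rule LeastI_ex[where P = "\<lambda>k. (u, v) \<in> R ^^ k"])
  then obtain g where g: "g 0 = u" "g k = v" "\<And>i. i < k \<Longrightarrow> (g i, g (Suc i)) \<in> R"
    by (auto simp: relpow_fun_conv)
  have rel: "(g i, g j) \<in> R ^^ (j - i)" if "i \<le> j" "j \<le> k" for i j
    unfolding relpow_fun_conv using that g(3) by (intro exI[of _ "\<lambda>l. g (i + l)"]) auto
  have "g i \<noteq> g j" if "i < j" "j \<le> k" for i j
  proof
    assume "g i = g j"
    then have "(u, v) \<in> R ^^ i O R ^^ (k - j)"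
      using rel[of 0 i] rel[of j k] that g(1,2) by auto
    then have "(u, v) \<in> R ^^ (i + (k - j))"
      by (simp add: relpow_add)
    then have "k \<le> i + (k - j)"
      unfolding k_def by (rule Least_le[where P = "\<lambda>k. (u, v) \<in> R ^^ k"])
    with that show False by simp
  qed
  then have "inj_on g {..k}"
    by (intro linorder_inj_onI') auto
  with g that show thesis by blast
qed

text \<open>A simple path in \<open>F\<close> from the terminus of \<open>e\<close> back to its
  origin closes up to a circuit. It does not backtrack at \<open>e\<close>, because \<open>F\<close>
  is closed under inversion and misses \<open>e\<close>, nor inside the path, because its vertices
  are distinct.\<close>

lemma circuit_if_extra_edge:
  assumes F: "F \<subseteq> T" "T \<subseteq> edges Y" "inversion Y ` F \<subseteq> F"
    and conn: "connected_graph (Y\<lparr>edges := F\<rparr>)" and e: "e \<in> T" "e \<notin> F"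
  shows "\<exists>es. circuit (Y\<lparr>edges := T\<rparr>) es"
proof -
  have e': "e \<in> edges Y" using e F by blast
  have "(terminus Y e, origin Y e) \<in> (adj Y F)\<^sup>*"
    using conn e' by (simp add: connected_graph_def)
  from simple_path[OF this] obtain g k where g: "g 0 = terminus Y e" "g k = origin Y e"
    "\<And>i. i < k \<Longrightarrow> (g i, g (Suc i)) \<in> adj Y F" "inj_on g {..k :: nat}"
    by blast
  have "\<exists>h\<in>F. origin Y h = g i \<and> terminus Y h = g (Suc i)" if "i < k" for i
    using g(3)[OF that] by auto
  then obtain h where h: "\<And>i. i < k \<Longrightarrow> h i \<in> F \<and> origin Y (h i) = g i \<and> terminus Y (h i) = g (Suc i)"
    by metis
  have hE: "h i \<in> edges Y" "h i \<in> F" "inversion Y (h i) \<in> F" if "i < k" for i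
    using h[OF that] F by auto
  have inv_e: "inversion Y e \<notin> F"
    using F e e' by (metis edge(6) image_subset_iff)
  have g_eq: "g i = g j \<longleftrightarrow> i = j" if "i \<le> k" "j \<le> k" for i j
    using g(4) that by (simp add: inj_on_eq_iff)
  let ?es = "e # map h [0..<k]"
  have "circuit (Y\<lparr>edges := T\<rparr>) ?es"
    unfolding circuit_def
  proof (intro conjI allI impI)
    show "set ?es \<subseteq> edges (Y\<lparr>edges := T\<rparr>)"
      using e F hE by auto
    have "map (origin (Y\<lparr>edges := T\<rparr>)) ?es = origin Y e # map g [0..<k]"
      using h by simp
    moreover have "distinct (origin Y e # map g [0..<k])"
      using g_eq by (auto simp: distinct_map inj_on_def g(2)[symmetric])
    ultimately show "distinct (map (origin (Y\<lparr>edges := T\<rparr>)) ?es)"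
      by presburger
  next
    fix i assume "i < length ?es"
    then have i: "i \<le> k" by simp
    show "let f = ?es ! (Suc i mod length ?es) in
        terminus (Y\<lparr>edges := T\<rparr>) (?es ! i) = origin (Y\<lparr>edges := T\<rparr>) f \<and>
        f \<noteq> inversion (Y\<lparr>edges := T\<rparr>) (?es ! i)"
    proof (cases i)
      case 0
      show ?thesis
      \<comment> \<open>For \<open>k = 0\<close> the edge \<open>e\<close> is a loop and forms the
        circuit alone.\<close>
      proof (cases "k = 0")
        case True
        then show ?thesis using 0 g(1,2) e' edge(7)[OF e'] by (auto simp del: edge(7))
      next
        case False
        then show ?thesis using 0 g(1) h[of 0] inv_e hE(2)[of 0] by (auto simp: Let_def)
      qed
    next
      case (Suc j)
      then have j: "j < k" using i by simp
      show ?thesis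
      proof (cases "Suc j < k")
        case True
        have "terminus Y (h (Suc j)) \<noteq> terminus Y (inversion Y (h j))"
          using h[OF True] h[OF j] hE(1)[OF j] g_eq[of "Suc (Suc j)" j] True by simp
        then have "h (Suc j) \<noteq> inversion Y (h j)" by metis
        with True show ?thesis using Suc j h[OF j] h[OF True] by (auto simp: Let_def)
      next
        case False
        then have "Suc j = k" using j by simp
        then show ?thesis using Suc j h[OF j] g(2) hE(3)[OF j] e(2) by (auto simp: Let_def)
      qed
    qed
  qed simp
  then show ?thesis by blast
qed

text \<open>A spanning tree with a marked vertex has exactly one orientation towards that vertex.
  For surjectivity, a breadth-first forest inside the tree \<open>T\<close> already uses all of
  \<open>T\<close>, as a leftover edge would create a circuit.\<close>

lemma bij_betw_chosen_edges:
  "bij_betw (\<lambda>f. (the_elem (roots Y f), chosen_edges Y f))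
     {f \<in> forests Y. card (roots Y f) = 1} (verts Y \<times> spanning_trees Y)"
  unfolding bij_betw_def
proof (intro conjI)
  show "inj_on (\<lambda>f. (the_elem (roots Y f), chosen_edges Y f)) {f \<in> forests Y. card (roots Y f) = 1}"
    by (rule inj_onI) (auto simp: card_1_singleton_iff intro: inj_chosen_edges)
  show "(\<lambda>f. (the_elem (roots Y f), chosen_edges Y f)) ` {f \<in> forests Y. card (roots Y f) = 1} =
      verts Y \<times> spanning_trees Y"
  proof (intro equalityI subsetI)
    fix z assume "z \<in> (\<lambda>f. (the_elem (roots Y f), chosen_edges Y f)) ` {f \<in> forests Y. card (roots Y f) = 1}"
    then obtain f r where "f \<in> forests Y" "roots Y f = {r}" "z = (r, chosen_edges Y f)"
      by (auto simp: card_1_singleton_iff)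
    then show "z \<in> verts Y \<times> spanning_trees Y"
      using chosen_edges_spanning_tree by (auto simp: roots_def)
  next
    fix z assume "z \<in> verts Y \<times> spanning_trees Y"
    then obtain r T where z: "z = (r, T)" "r \<in> verts Y" and T: "T \<subseteq> edges Y" "inversion Y ` T \<subseteq> T"
      "tree (Y\<lparr>edges := T\<rparr>)"
      by (auto simp: spanning_trees_def)
    have "\<exists>f\<in>forests Y. roots Y f = {r} \<and> (\<forall>v\<in>verts Y. \<forall>e. f v = Some e \<longrightarrow> e \<in> T)"
      using T z(2) by (intro forest_exists) (auto simp: tree_def)
    then obtain f where f: "f \<in> forests Y" "roots Y f = {r}"
      "\<And>v e. v \<in> verts Y \<Longrightarrow> f v = Some e \<Longrightarrow> e \<in> T"
      by blast
    have f': "f \<in> PiE (verts Y) (choices Y)"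
      using f by (auto simp: forests_def)
    have sub: "chosen_edges Y f \<subseteq> T"
      using f(3) T(2) by (auto simp: chosen_edges_def Let_def)
    have "chosen_edges Y f = T"
      using circuit_if_extra_edge[OF sub T(1) chosen_edges_subset(2)[OF f']
          connected_chosen_edges[OF f(1,2)]] T(3) sub
      by (auto simp: tree_def)
    then show "z \<in> (\<lambda>f. (the_elem (roots Y f), chosen_edges Y f)) ` {f \<in> forests Y. card (roots Y f) = 1}"
      using f z by (intro image_eqI[of _ _ f]) auto
  qed
qed

lemma card_forests_one_root:
  "card {f \<in> forests Y. card (roots Y f) = 1} = card (verts Y) * num_spanning_trees Y"
  using bij_betw_same_card[OF bij_betw_chosen_edges]
  by (simp add: num_spanning_trees_def card_cartesian_product)

lemma num_spanning_trees_pos: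
  assumes "connected_graph Y" "verts Y \<noteq> {}"
  shows "num_spanning_trees Y > 0"
proof -
  obtain r where "r \<in> verts Y" using assms by blast
  then obtain f where f: "f \<in> forests Y" "roots Y f = {r}"
    using forest_exists[of "edges Y" r] assms by auto
  have "card {f \<in> forests Y. card (roots Y f) = 1} > 0"
    using f by (intro card_gt_0_iff[THEN iffD2]) (auto simp: finite_forests)
  then show ?thesis
    unfolding card_forests_one_root by simp
qed

text \<open>The coefficient of degree \<open>k\<close> counts the forests with \<open>k\<close>
  roots: there are none for \<open>k = 0\<close>, and for \<open>k = 1\<close> they are the pairs of
  a vertex and a spanning tree.\<close>

lemma matrix_tree:
  assumes "verts Y \<noteq> {}"
  shows "coeff (setdet (verts Y) (laplacian Y [:0, 1 :: 'a :: idom:] (\<lambda>_. 1))) 0 = 0"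
    and "coeff (setdet (verts Y) (laplacian Y [:0, 1 :: 'a :: idom:] (\<lambda>_. 1))) 1 =
      of_nat (card (verts Y) * num_spanning_trees Y)"
proof -
  have *: "coeff (setdet (verts Y) (laplacian Y [:0, 1 :: 'a:] (\<lambda>_. 1))) k =
      of_nat (card {f \<in> forests Y. card (roots Y f) = k})" for k
    by (simp add: setdet_laplacian coeff_sum monom_altdef[of "1 :: 'a", simplified, symmetric]
        sum.If_cases finite_forests Int_def conj_commute cong: conj_cong)
  have "card (roots Y f) \<noteq> 0" if "f \<in> forests Y" for f
    using roots_nonempty[OF that assms] by (auto simp: roots_def)
  then have "{f \<in> forests Y. card (roots Y f) = 0} = {}" by blast
  then show "coeff (setdet (verts Y) (laplacian Y [:0, 1 :: 'a:] (\<lambda>_. 1))) 0 = 0"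
    unfolding * by (metis card.empty of_nat_0)
  show "coeff (setdet (verts Y) (laplacian Y [:0, 1 :: 'a:] (\<lambda>_. 1))) 1 =
      of_nat (card (verts Y) * num_spanning_trees Y)"
    unfolding * card_forests_one_root ..
qed

end

section \<open>Roots of unity\<close>

text \<open>Identifies the multiset of an abstract factorisation with \<open>proots\<close>, over
  which all later products are taken.\<close>

lemma alg_closed_factorization:
  fixes f :: "'a :: alg_closed_field poly"
  assumes "f \<noteq> 0"
  shows "f = Polynomial.smult (lead_coeff f) (\<Prod>x\<in>#proots f. [:-x, 1:])"
    and "size (proots f) = degree f"
proof -
  obtain A where A: "f = Polynomial.smult (lead_coeff f) (\<Prod>x\<in>#A. [:-x, 1:])" "size A = degree f"
    using alg_closed_imp_factorization[OF assms] by blast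
  have "(\<Prod>x\<in>#M. [:-x, 1:]) \<noteq> 0" for M :: "'a multiset"
    by (auto simp: prod_mset_zero_iff)
  then have "proots (\<Prod>x\<in>#A. [:-x, 1:]) = A"
    by (induction A) (auto simp: proots_mult simp del: mult_pCons_left)
  moreover have "proots f = proots (\<Prod>x\<in>#A. [:-x, 1:])"
    using assms by (subst A(1)) simp
  ultimately show "f = Polynomial.smult (lead_coeff f) (\<Prod>x\<in>#proots f. [:-x, 1:])"
    "size (proots f) = degree f"
    using A by simp_all
qed

lemma poly_alg_closed_factorization:
  fixes f :: "'a :: alg_closed_field poly"
  assumes "f \<noteq> 0"
  shows "poly f z = lead_coeff f * (\<Prod>x\<in>#proots f. z - x)"
proof -
  have "poly (\<Prod>x\<in>#A. [:-x, 1:]) z = (\<Prod>x\<in>#A. z - x)" for A :: "'a multiset"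
    by (induction A) (simp_all add: algebra_simps)
  then show ?thesis
    by (subst alg_closed_factorization(1)[OF assms]) simp
qed

definition unity_roots :: "nat \<Rightarrow> 'a :: field set" where
  "unity_roots n = {z. z ^ n = 1}"

text \<open>In characteristic 0 the derivative \<open>n t^(n-1)\<close> has no root in common with
  \<open>t^n - 1\<close>, so all roots are simple and the multiset of roots is a set.\<close>

lemma proots_unity:
  fixes n :: nat
  assumes "n > 0"
  defines "f \<equiv> monom 1 n - 1 :: 'a :: {alg_closed_field, field_char_0} poly"
  shows "f \<noteq> 0" "lead_coeff f = 1" "degree f = n" "finite (unity_roots n :: 'a set)"
    "proots f = mset_set (unity_roots n)"
proof -
  have "degree (monom 1 n + - 1 :: 'a poly) = n"
    using assms(1) by (subst degree_add_eq_left) (simp_all add: degree_monom_eq)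
  then show deg: "degree f = n"
    by (simp add: f_def)
  then show lead: "lead_coeff f = 1"
    using assms(1) by (simp add: f_def coeff_diff)
  then show nz: "f \<noteq> 0"
    by auto
  have poly: "poly f z = 0 \<longleftrightarrow> z \<in> unity_roots n" for z
    by (simp add: f_def poly_monom unity_roots_def)
  then show fin: "finite (unity_roots n :: 'a set)"
    using poly_roots_finite[OF nz] by simp
  have order: "order z f = 1" if "z \<in> unity_roots n" for z
  proof -
    have "z \<noteq> 0" using that assms(1) by (auto simp: unity_roots_def power_0_left)
    then have "poly (pderiv f) z \<noteq> 0"
      using assms(1) by (simp add: f_def pderiv_diff pderiv_monom poly_monom)
    then have "order z (pderiv f) = 0"
      by (simp add: order_0I)
    then show ?thesis
      using order_pderiv[OF nz, of z] poly that by simp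
  qed
  show "proots f = mset_set (unity_roots n)"
  proof (rule multiset_eqI)
    fix z
    show "count (proots f) z = count (mset_set (unity_roots n)) z"
      using order[of z] poly[of z] fin nz
      by (cases "z \<in> unity_roots n") (auto simp: order_0I)
  qed
qed

lemma prod_unity_roots:
  fixes x :: "'a :: {alg_closed_field, field_char_0}"
  assumes "n > 0"
  shows "(\<Prod>z\<in>unity_roots n. x - z) = x ^ n - 1"
  using poly_alg_closed_factorization[OF proots_unity(1)[OF assms], of x]
    proots_unity(2,5)[OF assms, where 'a = 'a]
  by (simp add: poly_monom prod_unfold_prod_mset)

lemma card_unity_roots:
  assumes "n > 0"
  shows "card (unity_roots n :: 'a :: {alg_closed_field, field_char_0} set) = n"
  using alg_closed_factorization(2)[OF proots_unity(1)[OF assms, where 'a = 'a]]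
    proots_unity(3,5)[OF assms, where 'a = 'a]
  by simp

section \<open>Powers of p-adic units\<close>

context padic_closure
begin

declare absv_eq_0_iff [simp]

section \<open>Ultrametric estimates\<close>

lemma p_pos: "p > 0" and p_gt_1: "real p > 1"
  using prime prime_gt_1_nat[of p] by (simp_all add: prime_gt_0_nat)

lemma absv_0 [simp]: "absv 0 = 0"
  by (simp add: absv_eq_0_iff)

lemma absv_pos_iff [simp]: "absv x > 0 \<longleftrightarrow> x \<noteq> 0"
  using absv_nonneg[of x] absv_eq_0_iff[of x] by linarith

lemma absv_1 [simp]: "absv 1 = 1"
proof -
  have "absv 1 * absv 1 = absv 1" using absv_mult[of 1 1] by simp
  then show ?thesis using absv_eq_0_iff[of 1] by simp
qed

lemma absv_power: "absv (x ^ n) = absv x ^ n"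
  by (induction n) (simp_all add: absv_mult)

lemma absv_eq_1_if_power_eq_1:
  assumes "z ^ i = 1" "i > 0"
  shows "absv z = 1"
proof (rule power_eq_imp_eq_base)
  show "absv z ^ i = 1 ^ i"
    using absv_power[of z i] assms(1) by simp
qed (use assms(2) absv_nonneg in auto)

lemma absv_minus [simp]: "absv (- x) = absv x"
proof -
  have "absv (-1) ^ 2 = 1" using absv_power[of "-1" 2] by simp
  then have "absv (-1) = 1" using absv_nonneg[of "-1"] by (simp add: power2_eq_1_iff)
  then show ?thesis using absv_mult[of "-1" x] by simp
qed

lemma absv_diff_commute: "absv (x - y) = absv (y - x)"
  using absv_minus[of "x - y"] by simp

lemma absv_diff: "absv (x - y) \<le> max (absv x) (absv y)"
  using absv_add[of x "- y"] by simp

lemma absv_divide: "absv (x / y) = absv x / absv y"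
proof (cases "y = 0")
  case False
  then have "absv x = absv (x / y) * absv y"
    by (metis absv_mult nonzero_eq_divide_eq)
  with False show ?thesis by (simp add: absv_eq_0_iff)
qed simp

lemma absv_prod: "absv (\<Prod>x\<in>A. f x) = (\<Prod>x\<in>A. absv (f x))"
  by (induction A rule: infinite_finite_induct) (simp_all add: absv_mult)

lemma absv_prod_mset: "absv (\<Prod>x\<in>#A. f x) = (\<Prod>x\<in>#A. absv (f x))"
  by (induction A) (simp_all add: absv_mult)

text \<open>The larger term dominates: \<open>y\<close> is the difference of \<open>x + y\<close>
  and \<open>x\<close>, so \<open>x + y\<close> cannot be smaller than \<open>y\<close>.\<close>

lemma absv_add_eq:
  assumes "absv x < absv y"
  shows "absv (x + y) = absv y"
proof (rule antisym)
  show "absv (x + y) \<le> absv y" using absv_add[of x y] assms by simp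
  show "absv y \<le> absv (x + y)" using absv_diff[of "x + y" x] assms by (auto simp: max_def split: if_splits)
qed

lemma absv_sum_le:
  assumes "\<And>i. i \<in> A \<Longrightarrow> absv (f i) \<le> c" "c \<ge> 0"
  shows "absv (\<Sum>i\<in>A. f i) \<le> c"
  using assms(1)
proof (induction A rule: infinite_finite_induct)
  case (insert x A)
  then show ?case using absv_add[of "f x" "\<Sum>i\<in>A. f i"] by force
qed (use assms(2) in auto)

lemma absv_sum_less:
  assumes "\<And>i. i \<in> A \<Longrightarrow> absv (f i) < c" "c > 0"
  shows "absv (\<Sum>i\<in>A. f i) < c"
  using assms(1)
proof (induction A rule: infinite_finite_induct)
  case (insert x A)
  then show ?case using absv_add[of "f x" "\<Sum>i\<in>A. f i"] by force
qed (use assms(2) in auto)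

lemma absv_of_nat:
  assumes "n > 0"
  shows "absv (of_nat n) = (1 / real p) ^ multiplicity p n"
proof -
  have eq: "of_nat n = (of_rat (rat_of_int (int n)) :: 'k)" by simp
  obtain m where m: "n = p ^ multiplicity p n * m" "\<not> p dvd m"
    using multiplicity_decompose'[of n p] assms prime by (metis not_prime_unit gr_implies_not0)
  have "multiplicity (int p) (int n) = multiplicity p n"
  proof (rule multiplicity_decomposeI)
    show "int n = int p ^ multiplicity p n * int m"
      by (subst m(1)) simp
  qed (use m(2) p_pos in auto)
  then show ?thesis
    unfolding eq absv_of_rat
    using assms by (simp add: padic_abs_rat_def power_int_minus power_one_over inverse_eq_divide)
qed

lemma absv_p: "absv (of_nat p) = 1 / real p"
  using absv_of_nat[OF p_pos] prime by (simp add: multiplicity_self prime_gt_0_nat)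

lemma absv_of_nat_coprime:
  assumes "coprime m p"
  shows "absv (of_nat m) = 1"
proof -
  have "\<not> p dvd m"
    using assms prime by (metis coprime_absorb_right not_prime_unit)
  then show ?thesis
    using absv_of_nat[of m] by (cases "m = 0") (auto simp: not_dvd_imp_multiplicity_0)
qed

lemma absv_of_nat_le_1: "absv (of_nat n) \<le> 1"
  using absv_of_nat[of n] p_gt_1 by (cases "n = 0") (auto simp: power_le_one)

lemma absv_of_nat_dvd:
  assumes "p dvd n"
  shows "absv (of_nat n) \<le> 1 / real p"
proof -
  obtain k where "n = p * k" using assms by blast
  then have "absv (of_nat n) = 1 / real p * absv (of_nat k)"
    by (simp add: absv_mult absv_p)
  with absv_of_nat_le_1[of k] show ?thesis
    by (simp add: divide_right_mono)
qed

section \<open>Units close to 1 and their powers\<close>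

lemma absv_unit:
  assumes "absv (u - 1) < 1"
  shows "absv u = 1"
  using absv_add_eq[of "u - 1" 1] assms by simp

text \<open>The cofactor of \<open>u - 1\<close> in \<open>u ^ i - 1\<close> is a sum of units,
  hence integral.\<close>

lemma absv_unit_power:
  assumes "absv (u - 1) < 1"
  shows "absv (u ^ i - 1) < 1"
proof -
  have "u ^ i - 1 = (u - 1) * (\<Sum>j<i. u ^ j)" by (rule power_diff_1_eq)
  moreover have "absv (\<Sum>j<i. u ^ j) \<le> 1"
    by (intro absv_sum_le) (simp_all add: absv_power absv_unit[OF assms])
  ultimately show ?thesis
    using assms absv_nonneg[of "u - 1"] by (simp add: absv_mult mult_le_one order.strict_trans1[OF mult_left_le])
qed

text \<open>The cofactor of \<open>u - 1\<close> is a sum of \<open>m\<close> terms close to 1,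
  hence close to \<open>m\<close>, which is a p-adic unit.\<close>

lemma absv_unit_power_coprime:
  assumes "absv (u - 1) < 1" "coprime m p"
  shows "absv (u ^ m - 1) = absv (u - 1)"
proof -
  have "absv (\<Sum>i<m. u ^ i - 1) < 1"
    by (intro absv_sum_less absv_unit_power assms) simp
  then have "absv ((\<Sum>i<m. u ^ i - 1) + of_nat m) = 1"
    using absv_add_eq[of "\<Sum>i<m. u ^ i - 1" "of_nat m"] absv_of_nat_coprime[OF assms(2)] by simp
  then show ?thesis
    by (simp add: power_diff_1_eq[of u m] absv_mult sum_subtractf)
qed

lemma power_p_expansion:
  fixes u :: 'k
  shows
  "u ^ p - 1 = (u - 1) ^ p + (\<Sum>k\<in>{1..<p}. of_nat (p choose k) * (u - 1) ^ k)"
proof -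
  have "u ^ p = (\<Sum>k\<le>p. of_nat (p choose k) * (u - 1) ^ k)"
    using binomial_ring[of "u - 1" 1 p] by simp
  also have "{..p} = insert 0 (insert p {1..<p})" using p_pos by auto
  finally show ?thesis using p_pos by simp
qed

lemma absv_choose_le:
  assumes "k \<in> {1..<p}"
  shows "absv (of_nat (p choose k) * x ^ k) \<le> absv x ^ k / real p"
proof -
  have "p dvd (p choose k)" using assms prime by (intro dvd_choose_prime) auto
  then show ?thesis
    using mult_right_mono[OF absv_of_nat_dvd, of "p choose k" "absv x ^ k"] absv_nonneg[of x]
    by (simp add: absv_mult absv_power)
qed

text \<open>In the binomial expansion only the last term \<open>(u - 1) ^ p\<close> escapes the
  factor \<open>p\<close>.\<close>

lemma absv_power_p_le:
  assumes "absv (u - 1) < 1"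
  shows "absv (u ^ p - 1) \<le> max (absv (u - 1) ^ p) (absv (u - 1) / real p)"
proof -
  let ?a = "absv (u - 1)"
  have "absv (\<Sum>k\<in>{1..<p}. of_nat (p choose k) * (u - 1) ^ k) \<le> ?a / real p"
  proof (rule absv_sum_le)
    fix k assume k: "k \<in> {1..<p}"
    have "?a ^ k \<le> ?a"
      using k assms absv_nonneg[of "u - 1"] power_decreasing[of 1 k ?a] by simp
    then show "absv (of_nat (p choose k) * (u - 1) ^ k) \<le> ?a / real p"
      using absv_choose_le[OF k, of "u - 1"] p_gt_1 by (meson divide_right_mono of_nat_0_le_iff order_trans)
  qed (use absv_nonneg in simp)
  then show ?thesis
    unfolding power_p_expansion[of u]
    using absv_add[of "(u - 1) ^ p" "\<Sum>k\<in>{1..<p}. of_nat (p choose k) * (u - 1) ^ k"]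
    by (simp add: absv_power)
qed

text \<open>The second hypothesis places \<open>absv (u - 1)\<close> below \<open>p\<close> to the
  power \<open>-1/(p-1)\<close>. This makes \<open>(u - 1) ^ p\<close> smaller than the linear term
  \<open>p (u - 1)\<close>, and the terms in between carry a further factor \<open>u - 1\<close>; so
  the linear term dominates.\<close>

lemma absv_power_p_eq:
  assumes "absv (u - 1) < 1" "absv (u - 1) ^ (p - 1) < 1 / real p"
  shows "absv (u ^ p - 1) = absv (u - 1) / real p"
proof (cases "u = 1")
  case False
  let ?a = "absv (u - 1)"
  have a: "?a > 0" using False by simp
  have p2: "p \<ge> 2" using prime by (rule prime_ge_2_nat)
  have "absv (\<Sum>k\<in>{2..<p}. of_nat (p choose k) * (u - 1) ^ k) < ?a / real p"
  proof (rule absv_sum_less)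
    fix k assume k: "k \<in> {2..<p}"
    have "?a ^ k \<le> ?a * ?a"
      using k assms a absv_nonneg[of "u - 1"] power_decreasing[of 2 k ?a] by (simp add: power2_eq_square)
    also have "\<dots> < ?a" using a assms(1) by simp
    finally have "?a ^ k / real p < ?a / real p"
      using p_gt_1 by (simp add: divide_strict_right_mono)
    moreover have "absv (of_nat (p choose k) * (u - 1) ^ k) \<le> ?a ^ k / real p"
      using absv_choose_le[of k "u - 1"] k by simp
    ultimately show "absv (of_nat (p choose k) * (u - 1) ^ k) < ?a / real p" by simp
  qed (use a p_gt_1 in simp)
  moreover have "absv ((u - 1) ^ p) < ?a / real p"
  proof -
    have "?a ^ p = ?a * ?a ^ (p - 1)" using p_pos by (simp add: power_eq_if)
    also have "\<dots> < ?a * (1 / real p)" using a assms(2) by (intro mult_strict_left_mono) auto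
    finally show ?thesis by (simp add: absv_power)
  qed
  ultimately have "absv ((u - 1) ^ p + (\<Sum>k\<in>{2..<p}. of_nat (p choose k) * (u - 1) ^ k)) < ?a / real p"
    using absv_add[of "(u - 1) ^ p" "\<Sum>k\<in>{2..<p}. of_nat (p choose k) * (u - 1) ^ k"] by linarith
  moreover have "{1..<p} = insert 1 {2..<p}" using p2 by auto
  then have "u ^ p - 1 = ((u - 1) ^ p + (\<Sum>k\<in>{2..<p}. of_nat (p choose k) * (u - 1) ^ k)) + of_nat p * (u - 1)"
    unfolding power_p_expansion[of u] by simp
  ultimately show ?thesis
    using absv_add_eq[of _ "of_nat p * (u - 1)"] by (simp add: absv_mult absv_p)
qed (use p_pos in simp)

text \<open>The residue field has characteristic \<open>p\<close>, so its Frobenius map is injective.\<close>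

lemma absv_power_p_lt_1_imp:
  assumes "absv v \<le> 1" "absv (v ^ (p ^ k) - 1) < 1"
  shows "absv (v - 1) < 1"
  using assms
proof (induction k arbitrary: v)
  case (Suc k)
  have le: "absv (v ^ (p ^ k)) \<le> 1" using Suc.prems(1) by (simp add: absv_power absv_nonneg power_le_one)
  let ?w = "v ^ (p ^ k)"
  have w1: "absv (?w - 1) \<le> 1" using absv_diff[of ?w 1] le by simp
  have "absv (\<Sum>k\<in>{1..<p}. of_nat (p choose k) * (?w - 1) ^ k) < 1"
  proof (rule absv_sum_less)
    fix j assume j: "j \<in> {1..<p}"
    have "absv (?w - 1) ^ j / real p \<le> 1 / real p"
      using w1 absv_nonneg[of "?w - 1"] p_gt_1 by (intro divide_right_mono power_le_one) auto
    also have "\<dots> < 1" using p_gt_1 by simp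
    finally show "absv (of_nat (p choose j) * (?w - 1) ^ j) < 1"
      using absv_choose_le[OF j, of "?w - 1"] by simp
  qed simp
  moreover have "absv (?w ^ p - 1) < 1"
    using Suc.prems(2) by (simp add: power_mult[symmetric] mult.commute)
  ultimately have "absv ((?w - 1) ^ p) < 1"
    using power_p_expansion[of ?w] absv_diff[of "?w ^ p - 1" "\<Sum>k\<in>{1..<p}. of_nat (p choose k) * (?w - 1) ^ k"]
    by simp
  then have "absv (?w - 1) < 1"
    using absv_nonneg[of "?w - 1"] by (simp add: absv_power power_less_one_iff)
  then show ?case using Suc.IH[OF Suc.prems(1)] by blast
qed simp

text \<open>The distance to 1 only shrinks, so \<open>absv_power_p_eq\<close> applies again at every
  step.\<close>

lemma absv_power_p_pow_small:
  assumes "absv (u - 1) < 1" "absv (u - 1) ^ (p - 1) < 1 / real p"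
  shows "absv (u ^ (p ^ i) - 1) = absv (u - 1) / real p ^ i"
proof (induction i)
  case (Suc i)
  let ?w = "u ^ (p ^ i)"
  have le: "absv (?w - 1) \<le> absv (u - 1)"
    unfolding Suc using p_gt_1 absv_nonneg[of "u - 1"]
    by (intro divide_le_eq[THEN iffD2]) (simp add: mult_left_mono one_le_power mult_le_cancel_left1)
  then have "absv (?w - 1) ^ (p - 1) \<le> absv (u - 1) ^ (p - 1)"
    using absv_nonneg by (intro power_mono)
  then have "absv (?w ^ p - 1) = absv (?w - 1) / real p"
    using le assms by (intro absv_power_p_eq) linarith+
  then show ?case
    using Suc by (simp add: power_mult[symmetric] mult.commute)
qed simp

text \<open>As long as the region of exact division by \<open>p\<close> has not been entered, the
  distance after \<open>i\<close> steps is at most the \<open>p^i\<close>-th power of the original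
  one; by the hypothesis this forces entry after \<open>s\<close> steps at the latest.\<close>

lemma absv_power_p_pow_threshold:
  assumes "absv (u - 1) < 1" "(absv (u - 1) ^ (p ^ s)) ^ (p - 1) < 1 / real p"
  shows "absv (u ^ (p ^ s) - 1) ^ (p - 1) < 1 / real p"
proof -
  let ?a = "\<lambda>i. absv (u ^ (p ^ i) - 1)"
  have "?a i ^ (p - 1) < 1 / real p \<or> ?a i \<le> absv (u - 1) ^ (p ^ i)" for i
  proof (induction i)
    case (Suc i)
    have lt: "?a i < 1" by (rule absv_unit_power[OF assms(1)])
    have step: "u ^ p ^ Suc i = (u ^ (p ^ i)) ^ p"
      by (simp add: power_mult[symmetric] mult.commute)
    show ?case
    proof (cases "?a i ^ (p - 1) < 1 / real p")
      case True
      then have "?a (Suc i) = ?a i / real p"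
        unfolding step using lt by (intro absv_power_p_eq)
      also have "\<dots> \<le> ?a i"
        using p_gt_1 absv_nonneg[of "u ^ (p ^ i) - 1"] by (simp add: divide_le_eq mult_le_cancel_left1)
      finally have "?a (Suc i) ^ (p - 1) \<le> ?a i ^ (p - 1)"
        using absv_nonneg by (intro power_mono)
      with True show ?thesis by linarith
    next
      case False
      \<comment> \<open>Outside that region the bound by \<open>?a i / real p\<close> is absorbed by
        the bound \<open>?a i ^ p\<close>.\<close>
      have "?a i / real p \<le> ?a i * ?a i ^ (p - 1)"
        using False mult_left_mono[of "1 / real p" "?a i ^ (p - 1)" "?a i"] absv_nonneg by simp
      also have "\<dots> = ?a i ^ p" using p_pos by (simp add: power_eq_if)
      finally have "?a (Suc i) \<le> ?a i ^ p"
        unfolding step using absv_power_p_le[OF lt] by simp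
      also have "\<dots> \<le> (absv (u - 1) ^ (p ^ i)) ^ p"
        using Suc False absv_nonneg by (intro power_mono) auto
      finally show ?thesis by (simp add: power_mult[symmetric] mult.commute)
    qed
  qed simp
  from this[of s] show ?thesis
  proof
    assume "?a s \<le> absv (u - 1) ^ (p ^ s)"
    then have "?a s ^ (p - 1) \<le> (absv (u - 1) ^ (p ^ s)) ^ (p - 1)"
      using absv_nonneg by (intro power_mono)
    with assms(2) show ?thesis by linarith
  qed
qed

section \<open>Teichmuller representatives\<close>

lemma residue_class_eq:
  assumes "absv (x - y) < 1"
  shows "residue_class absv x = residue_class absv y"
proof -
  have "absv (z - y) < 1 \<longleftrightarrow> absv (z - x) < 1" for z
    using assms absv_add[of "z - x" "x - y"] absv_add[of "z - y" "y - x"] absv_diff_commute[of x y]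
    by auto
  then show ?thesis by (simp add: residue_class_def)
qed

text \<open>Uniqueness: the quotient of two roots of unity of order prime to \<open>p\<close> with
  the same residue is close to 1. Raising it to the power \<open>l * m\<close>, prime to
  \<open>p\<close>, preserves its distance to 1 and gives 1.\<close>

lemma teichmuller_eq:
  assumes \<zeta>: "\<zeta> ^ m = 1" "m > 0" "coprime m p" and near: "absv (\<beta> - \<zeta>) < 1"
  shows "teichmuller p absv (residue_class absv \<beta>) = \<zeta>"
  unfolding teichmuller_def
proof (rule the_equality)
  show "(\<exists>m>0. coprime m p \<and> \<zeta> ^ m = 1) \<and> residue_class absv \<zeta> = residue_class absv \<beta>"
    using \<zeta> near residue_class_eq[OF near] by auto
next
  fix \<omega> assume \<omega>: "(\<exists>m>0. coprime m p \<and> \<omega> ^ m = 1) \<and> residue_class absv \<omega> = residue_class absv \<beta>"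
  then obtain l where l: "l > 0" "coprime l p" "\<omega> ^ l = 1" by blast
  note unit = absv_eq_1_if_power_eq_1
  have "\<omega> \<in> residue_class absv \<omega>"
    using unit[OF l(3,1)] by (simp add: residue_class_def)
  then have "\<omega> \<in> residue_class absv \<beta>"
    using \<omega> by simp
  then have "absv (\<omega> - \<beta>) < 1"
    by (simp add: residue_class_def)
  then have "absv (\<omega> - \<zeta>) < 1"
    using absv_add[of "\<omega> - \<beta>" "\<beta> - \<zeta>"] near by simp
  moreover have nz: "\<zeta> \<noteq> 0" using unit[OF \<zeta>(1,2)] by auto
  ultimately have "absv (\<omega> / \<zeta> - 1) < 1"
    using unit[OF \<zeta>(1,2)] absv_divide[of "\<omega> - \<zeta>" \<zeta>] by (simp add: diff_divide_distrib)
  moreover have "coprime (l * m) p" using l \<zeta> by simp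
  ultimately have "absv (\<omega> / \<zeta> - 1) = absv ((\<omega> / \<zeta>) ^ (l * m) - 1)"
    by (rule absv_unit_power_coprime[symmetric])
  also have "(\<omega> / \<zeta>) ^ (l * m) = 1"
  proof -
    have "\<omega> ^ (l * m) = 1" using l(3) by (simp add: power_mult)
    moreover have "\<zeta> ^ (l * m) = 1" using \<zeta>(1) by (simp add: power_mult mult.commute[of l])
    ultimately show ?thesis by (simp add: power_divide)
  qed
  finally show "\<omega> = \<zeta>" using nz by (simp add: absv_eq_0_iff)
qed

lemma decompose_p:
  assumes "n > 0"
  obtains m where "n = p ^ multiplicity p n * m" "coprime m p" "m > 0"
proof -
  obtain m where m: "n = p ^ multiplicity p n * m" "\<not> p dvd m"
    using multiplicity_decompose'[of n p] assms prime by (metis not_prime_unit gr_implies_not0)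
  then have "coprime m p"
    using prime by (metis coprime_commute prime_imp_coprime)
  moreover have "m > 0"
    using m(2) by (auto intro: gr0I)
  ultimately show thesis using m(1) that by blast
qed

text \<open>Splitting \<open>x\<^sup>m - 1\<close> produces the Teichmuller lift without Hensel's lemma.\<close>

lemma teichmuller_exists:
  assumes "absv \<beta> = 1" "absv (\<beta> ^ n - 1) < 1" "n > 0"
  shows "teichmuller p absv (residue_class absv \<beta>) ^ n = 1"
    and "absv (teichmuller p absv (residue_class absv \<beta>)) = 1"
    and "absv (\<beta> - teichmuller p absv (residue_class absv \<beta>)) < 1"
proof -
  obtain m where m: "n = p ^ multiplicity p n * m" "coprime m p" "m > 0"
    using decompose_p[OF assms(3)] .
  have "absv ((\<beta> ^ m) ^ (p ^ multiplicity p n) - 1) < 1"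
    using assms(2) m(1) by (simp add: power_mult[symmetric] mult.commute)
  \<comment> \<open>Injectivity of Frobenius removes the \<open>p\<close>-part of \<open>n\<close>
    and leaves an exponent \<open>m\<close> prime to \<open>p\<close>.\<close>
  then have "absv (\<beta> ^ m - 1) < 1"
    using absv_power_p_lt_1_imp[of "\<beta> ^ m"] assms(1) by (simp add: absv_power)
  then have "(\<Prod>z\<in>unity_roots m. absv (\<beta> - z)) < 1"
    by (simp add: prod_unity_roots[OF m(3), symmetric] absv_prod)
  then have "\<exists>z\<in>unity_roots m. absv (\<beta> - z) < 1"
    using prod_ge_1[of "unity_roots m" "\<lambda>z. absv (\<beta> - z)"] by (meson not_less)
  then obtain \<zeta> where \<zeta>: "\<zeta> ^ m = 1" "absv (\<beta> - \<zeta>) < 1"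
    by (auto simp: unity_roots_def)
  have eq: "teichmuller p absv (residue_class absv \<beta>) = \<zeta>"
    using teichmuller_eq[OF \<zeta>(1) m(3,2) \<zeta>(2)] .
  show "teichmuller p absv (residue_class absv \<beta>) ^ n = 1"
    unfolding eq by (subst m(1), subst mult.commute) (simp add: power_mult \<zeta>(1))
  show "absv (teichmuller p absv (residue_class absv \<beta>)) = 1"
    unfolding eq using \<zeta>(1) m(3) by (rule absv_eq_1_if_power_eq_1)
  show "absv (\<beta> - teichmuller p absv (residue_class absv \<beta>)) < 1"
    unfolding eq by (rule \<zeta>(2))
qed

section \<open>Valuations of the factors \<open>\<beta> ^ n - 1\<close>\<close>

definition vord :: "'k \<Rightarrow> real" where
  "vord x = - log (real p) (absv x)"

text \<open>Away from 0 the extended order is finite, so all computations with valuations can take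
  place in the reals.\<close>

lemma padic_ord_eq_vord: "x \<noteq> 0 \<Longrightarrow> padic_ord p absv x = ereal (vord x)"
  by (simp add: padic_ord_def vord_def)

lemma vord_1 [simp]: "vord 1 = 0"
  by (simp add: vord_def)

lemma vord_mult: "x \<noteq> 0 \<Longrightarrow> y \<noteq> 0 \<Longrightarrow> vord (x * y) = vord x + vord y"
  using p_gt_1 by (simp add: vord_def absv_mult log_mult)

lemma vord_power: "x \<noteq> 0 \<Longrightarrow> vord (x ^ n) = real n * vord x"
  by (induction n) (simp_all add: vord_mult algebra_simps)

lemma vord_prod_mset:
  "(\<And>x. x \<in># A \<Longrightarrow> f x \<noteq> 0) \<Longrightarrow> vord (\<Prod>x\<in>#A. f x) = (\<Sum>x\<in>#A. vord (f x))"
proof (induction A)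
  case (add x A)
  then have "0 \<notin># image_mset f A" by force
  with add show ?case by (simp add: vord_mult prod_mset_zero_iff)
qed simp

lemma vord_of_nat: "n > 0 \<Longrightarrow> vord (of_nat n) = real (multiplicity p n)"
  using p_gt_1 by (simp add: vord_def absv_of_nat log_nat_power power_one_over log_divide log_inverse inverse_eq_divide[symmetric])

text \<open>The part of \<open>n\<close> prime to \<open>p\<close> does not change the distance. The
  first \<open>r\<close> of the \<open>k\<close> steps of raising to the power \<open>p\<close> are
  left unevaluated; if \<open>k\<close> exceeds \<open>s\<close>, the threshold has been passed by
  then and each of the remaining steps divides by exactly \<open>p\<close>.\<close>

lemma absv_power_n:
  assumes "absv (u - 1) < 1" "n > 0" "(absv (u - 1) ^ (p ^ s)) ^ (p - 1) < 1 / real p"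
  defines "k \<equiv> multiplicity p n"
  defines "r \<equiv> min k s"
  shows "absv (u ^ n - 1) = absv (u ^ (p ^ r) - 1) / real p ^ (k - r)"
proof -
  obtain m where m: "n = p ^ k * m" "coprime m p" "m > 0"
    unfolding k_def using decompose_p[OF assms(2)] .
  have "absv (u ^ n - 1) = absv (u ^ (p ^ k) - 1)"
    using absv_unit_power_coprime[OF absv_unit_power[OF assms(1)] m(2), of "p ^ k"]
    by (simp add: m(1) power_mult)
  also have "\<dots> = absv (u ^ (p ^ r) - 1) / real p ^ (k - r)"
  proof (cases "k \<le> s")
    case False
    then have "u ^ (p ^ k) = (u ^ (p ^ s)) ^ (p ^ (k - s))"
      by (simp add: power_mult[symmetric] power_add[symmetric])
    with False show ?thesis
      using absv_power_p_pow_small[OF absv_unit_power[OF assms(1)] absv_power_p_pow_threshold[OF assms(1,3)]]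
      by (simp add: r_def)
  qed (simp add: r_def)
  finally show ?thesis .
qed

text \<open>The inequality in the definition of \<open>s_inv\<close>, read multiplicatively. Its
  order is positive and finite, so some \<open>s\<close> satisfies it and the \<open>LEAST\<close>
  one does.\<close>

lemma s_inv_threshold:
  fixes \<beta> :: 'k
  defines "\<tau> \<equiv> teichmuller p absv (residue_class absv \<beta>)"
  assumes "absv (\<beta> - \<tau>) < 1" "\<beta> \<noteq> \<tau>"
  shows "(absv (\<beta> - \<tau>) ^ (p ^ s_inv p absv \<beta>)) ^ (p - 1) < 1 / real p"
proof -
  let ?a = "absv (\<beta> - \<tau>)"
  have a: "?a > 0" using assms(3) by simp
  have w: "vord (\<beta> - \<tau>) > 0"
    using assms(2) a p_gt_1 by (simp add: vord_def log_less_zero_cancel_iff)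
  have P: "ereal (real p ^ s * (real p - 1)) * padic_ord p absv (\<beta> - \<tau>) > 1 \<longleftrightarrow>
      real p ^ s * (real p - 1) * vord (\<beta> - \<tau>) > 1" for s
    using assms(3) by (simp add: padic_ord_eq_vord one_ereal_def)
  obtain s where "1 / ((real p - 1) * vord (\<beta> - \<tau>)) < real p ^ s"
    using real_arch_pow[OF p_gt_1] by blast
  then have "real p ^ s * (real p - 1) * vord (\<beta> - \<tau>) > 1"
    using w p_gt_1 by (simp add: field_simps)
  then have "\<exists>s. ereal (real p ^ s * (real p - 1)) * padic_ord p absv (\<beta> - \<tau>) > 1"
    using P by blast
  then have "ereal (real p ^ s_inv p absv \<beta> * (real p - 1)) * padic_ord p absv (\<beta> - \<tau>) > 1"
    unfolding s_inv_def \<tau>_def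
    by (rule LeastI_ex[where P = "\<lambda>s. ereal (real p ^ s * (real p - 1)) *
      padic_ord p absv (\<beta> - teichmuller p absv (residue_class absv \<beta>)) > 1"])
  then have "real p ^ s_inv p absv \<beta> * (real p - 1) * vord (\<beta> - \<tau>) > 1"
    using P by blast
  then have "real (p ^ s_inv p absv \<beta> * (p - 1)) * log (real p) ?a < - 1"
    using p_pos by (simp add: vord_def of_nat_diff)
  then have "log (real p) (?a ^ (p ^ s_inv p absv \<beta> * (p - 1))) < - 1"
    by (simp only: log_nat_power absv_nonneg)
  then have "?a ^ (p ^ s_inv p absv \<beta> * (p - 1)) < real p powr - 1"
    using a p_gt_1 by (subst (asm) log_less_iff) simp_all
  then show ?thesis
    using p_gt_1 by (simp add: power_mult powr_minus_divide)
qed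

text \<open>Division by \<open>\<tau>\<close> moves \<open>\<beta>\<close> close to 1 without
  changing absolute values, and \<open>\<tau> ^ n = 1\<close>; so \<open>absv_power_n\<close>
  applies to the quotient.\<close>

lemma vord_power_minus_1:
  fixes \<beta> :: 'k and n :: nat
  defines "\<tau> \<equiv> teichmuller p absv (residue_class absv \<beta>)"
  defines "r \<equiv> r_inv p absv n \<beta>"
  assumes "absv \<beta> = 1" "absv (\<beta> ^ n - 1) < 1" "n > 0" "\<beta> ^ n \<noteq> 1"
  shows "vord (\<beta> ^ n - 1) = vord (\<beta> ^ (p ^ r) - \<tau> ^ (p ^ r)) - real r + real (multiplicity p n)"
    and "\<beta> ^ (p ^ r) \<noteq> \<tau> ^ (p ^ r)"
proof -
  let ?k = "multiplicity p n" and ?s = "s_inv p absv \<beta>"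
  note \<tau> = teichmuller_exists[OF assms(3-5), folded \<tau>_def]
  define u where "u = \<beta> / \<tau>"
  have \<tau>0: "\<tau> \<noteq> 0" using \<tau>(2) by auto
  \<comment> \<open>Equality would give \<open>\<beta> ^ n = 1\<close>; excluding it keeps the order
    in \<open>s_inv\<close> finite.\<close>
  have "\<beta> \<noteq> \<tau>" using \<tau>(1) assms(6) by auto
  have u: "absv (u ^ i - 1) = absv (\<beta> ^ i - \<tau> ^ i)" for i
  proof -
    have "u ^ i - 1 = (\<beta> ^ i - \<tau> ^ i) / \<tau> ^ i"
      using \<tau>0 by (simp add: u_def power_divide diff_divide_distrib)
    then show ?thesis by (simp add: absv_divide absv_power \<tau>(2))
  qed
  have u1: "absv (u - 1) = absv (\<beta> - \<tau>)" using u[of 1] by simp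
  have thr: "(absv (u - 1) ^ (p ^ ?s)) ^ (p - 1) < 1 / real p"
    unfolding u1 using s_inv_threshold[of \<beta>] \<tau>(3) \<open>\<beta> \<noteq> \<tau>\<close> by (simp add: \<tau>_def)
  have r: "r = min ?k ?s" by (simp add: r_def r_inv_def)
  have eq: "absv (\<beta> ^ n - 1) = absv (\<beta> ^ (p ^ r) - \<tau> ^ (p ^ r)) / real p ^ (?k - r)"
    using absv_power_n[OF _ assms(5) thr] \<tau>(3) u[of n] u[of "p ^ r"]
    by (simp add: u1 r \<tau>(1))
  have pos: "absv (\<beta> ^ n - 1) > 0" using assms(6) by simp
  show ne: "\<beta> ^ (p ^ r) \<noteq> \<tau> ^ (p ^ r)"
    using pos unfolding eq by auto
  have "log (real p) (absv (\<beta> ^ n - 1)) =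
      log (real p) (absv (\<beta> ^ (p ^ r) - \<tau> ^ (p ^ r))) - real (?k - r)"
    unfolding eq using ne p_gt_1 by (simp add: log_divide log_nat_power)
  then show "vord (\<beta> ^ n - 1) = vord (\<beta> ^ (p ^ r) - \<tau> ^ (p ^ r)) - real r + real ?k"
    using r by (simp add: vord_def of_nat_diff)
qed

text \<open>Without cancellation between \<open>\<beta> ^ n\<close> and 1 the larger of the two
  decides, which is the contribution of \<open>\<beta>\<close> to the Mahler measure.\<close>

lemma vord_power_minus_1_cases:
  assumes "n > 0" "\<not> (absv \<beta> = 1 \<and> absv (\<beta> ^ n - 1) < 1)"
  shows "vord (\<beta> ^ n - 1) = - real n * log (real p) (max 1 (absv \<beta>))"
proof (cases "absv \<beta>" "1 :: real" rule: linorder_cases)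
  case less
  then have "absv (\<beta> ^ n) < 1"
    using assms(1) absv_nonneg[of \<beta>] by (simp add: absv_power power_less_one_iff)
  then have "absv (\<beta> ^ n - 1) = 1"
    using absv_add_eq[of "\<beta> ^ n" "- 1"] by simp
  with less show ?thesis by (simp add: vord_def max_def)
next
  case equal
  then have "absv (\<beta> ^ n - 1) = 1"
    using assms(2) absv_diff[of "\<beta> ^ n" 1] by (simp add: absv_power)
  with equal show ?thesis by (simp add: vord_def)
next
  case greater
  then have "absv (\<beta> ^ n) > 1"
    using assms(1) by (simp add: absv_power one_less_power)
  then have "absv (\<beta> ^ n - 1) = absv \<beta> ^ n"
    using absv_add_eq[of "- 1" "\<beta> ^ n"] by (simp add: absv_power)
  with greater show ?thesis by (simp add: vord_def max_def log_nat_power)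
qed

text \<open>The roots in \<open>A\<close> have absolute value 1 and leave the Mahler measure
  unchanged, while the other roots contribute to the Mahler measure alone.\<close>

lemma vord_prod_power_minus_1:
  fixes f :: "'k poly"
  assumes "f \<noteq> 0" "n > 0" and roots: "\<And>\<beta>. \<beta> \<in># proots f \<Longrightarrow> \<beta> ^ n \<noteq> 1"
  defines "A \<equiv> {#\<beta> \<in># proots f. absv \<beta> = 1 \<and> absv (\<beta> ^ n - 1) < 1#}"
  shows "vord (lead_coeff f ^ n * (\<Prod>\<beta>\<in>#proots f. \<beta> ^ n - 1)) =
    - real n * log (real p) (padic_mahler absv f) + real (size A) * real (multiplicity p n) +
    (\<Sum>\<beta>\<in>#A. vord (\<beta> ^ (p ^ r_inv p absv n \<beta>) -
        teichmuller p absv (residue_class absv \<beta>) ^ (p ^ r_inv p absv n \<beta>)) - real (r_inv p absv n \<beta>))"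
proof -
  let ?g = "\<lambda>\<beta>. vord (\<beta> ^ (p ^ r_inv p absv n \<beta>) -
        teichmuller p absv (residue_class absv \<beta>) ^ (p ^ r_inv p absv n \<beta>)) - real (r_inv p absv n \<beta>)"
  let ?P = "\<lambda>\<beta>. absv \<beta> = 1 \<and> absv (\<beta> ^ n - 1) < 1"
  have sum: "(\<Sum>\<beta>\<in>#M. vord (\<beta> ^ n - 1)) = - real n * log (real p) (\<Prod>\<beta>\<in>#M. max 1 (absv \<beta>)) +
      real (size (filter_mset ?P M)) * real (multiplicity p n) + (\<Sum>\<beta>\<in>#filter_mset ?P M. ?g \<beta>)"
    if "\<And>\<beta>. \<beta> \<in># M \<Longrightarrow> \<beta> ^ n \<noteq> 1" for M
    using that
  proof (induction M)
    case (add \<beta> M)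
    have pos: "(\<Prod>\<beta>\<in>#M. max 1 (absv \<beta>)) > 0"
      by (induction M) (simp_all add: less_max_iff_disj)
    have log: "log (real p) (max 1 (absv \<beta>) * (\<Prod>\<beta>\<in>#M. max 1 (absv \<beta>))) =
        log (real p) (max 1 (absv \<beta>)) + log (real p) (\<Prod>\<beta>\<in>#M. max 1 (absv \<beta>))"
      using pos by (intro log_mult_pos) (simp_all add: less_max_iff_disj)
    have "vord (\<beta> ^ n - 1) = - real n * log (real p) (max 1 (absv \<beta>)) +
        (if ?P \<beta> then ?g \<beta> + real (multiplicity p n) else 0)"
      using vord_power_minus_1(1)[of \<beta> n] vord_power_minus_1_cases[OF assms(2), of \<beta>] add.prems assms(2)
      by auto
    with add log show ?case
      by (cases "?P \<beta>") (auto simp: algebra_simps)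
  qed simp
  have lead: "lead_coeff f \<noteq> 0" using assms(1) by simp
  have "vord (lead_coeff f ^ n * (\<Prod>\<beta>\<in>#proots f. \<beta> ^ n - 1)) =
      real n * vord (lead_coeff f) + (\<Sum>\<beta>\<in>#proots f. vord (\<beta> ^ n - 1))"
    using lead roots vord_prod_mset[of "proots f" "\<lambda>\<beta>. \<beta> ^ n - 1"]
    by (subst vord_mult) (auto simp: vord_power prod_mset_zero_iff)
  moreover have "log (real p) (padic_mahler absv f) =
      log (real p) (absv (lead_coeff f)) + log (real p) (\<Prod>\<beta>\<in>#proots f. max 1 (absv \<beta>))"
  proof -
    have "(\<Prod>\<beta>\<in>#M. max 1 (absv \<beta>)) > 0" for M
      by (induction M) (simp_all add: less_max_iff_disj)
    then show ?thesis
      unfolding padic_mahler_def using lead by (intro log_mult_pos) simp_all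
  qed
  ultimately show ?thesis
    using sum[OF roots] by (simp add: A_def vord_def algebra_simps)
qed

end

section \<open>Cyclic covers\<close>

lemma mod_cover_simps:
  assumes "n > 0"
  shows "verts (mod_cover X \<alpha> n) = verts X \<times> {0..<int n}"
    "edges (mod_cover X \<alpha> n) = edges X \<times> {0..<int n}"
    "origin (mod_cover X \<alpha> n) (e, \<sigma>) = (origin X e, \<sigma>)"
    "terminus (mod_cover X \<alpha> n) (e, \<sigma>) = (terminus X e, (\<sigma> + \<alpha> e) mod int n)"
    "inversion (mod_cover X \<alpha> n) (e, \<sigma>) = (inversion X e, (\<sigma> + \<alpha> e) mod int n)"
  using assms by (simp_all add: mod_cover_def derived_graph_def integer_mod_group_def mod_add_right_eq)

lemma voltage_inversion:
  assumes "voltage_assignment X integer_group \<alpha>" "e \<in> edges X"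
  shows "\<alpha> (inversion X e) = - \<alpha> e"
  using assms by (simp add: voltage_assignment_def)

lemma (in finite_serre_graph) mod_cover_finite_serre:
  assumes "voltage_assignment Y integer_group \<alpha>" "n > 0"
  shows "finite_serre_graph (mod_cover Y \<alpha> n)"
proof
  show "serre_graph (mod_cover Y \<alpha> n)"
    unfolding serre_graph_def
    using voltage_inversion[OF assms(1)] assms(2)
    by (auto simp: mod_cover_simps mod_simps)
  show "finite_graph (mod_cover Y \<alpha> n)"
    using assms(2) by (simp add: finite_graph_def mod_cover_simps)
qed

text \<open>Reducing the second coordinate modulo \<open>n\<close> sends paths of the infinite cover
  to paths of the finite one.\<close>

lemma connected_mod_cover:
  assumes conn: "connected_graph (derived_graph X integer_group \<alpha>)" and n: "n > 0"
  shows "connected_graph (mod_cover X \<alpha> n)"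
proof -
  let ?Z = "derived_graph X integer_group \<alpha>" and ?Y = "mod_cover X \<alpha> n"
  have "((u, a mod int n), (v, b mod int n)) \<in> (adj ?Y (edges ?Y))\<^sup>*"
    if "((u, a), (v, b)) \<in> (adj ?Z (edges ?Z))\<^sup>*" for u v a b
    using that
  proof (induction rule: rtrancl_induct2)
    case (step v b w c)
    then obtain e where e: "e \<in> edges X" "v = origin X e" "w = terminus X e" "c = b + \<alpha> e"
      by (auto simp: derived_graph_def)
    have "((v, b mod int n), (w, c mod int n)) \<in> adj ?Y (edges ?Y)"
      using e n by (auto simp: mod_cover_simps mod_add_left_eq intro!: exI[of _ e] exI[of _ "b mod int n"])
    with step.IH show ?case by (rule rtrancl_into_rtrancl)
  qed simp
  moreover have "((u, a), (v, b)) \<in> (adj ?Z (edges ?Z))\<^sup>*" if "u \<in> verts X" "v \<in> verts X" for u v a b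
    using conn that by (auto simp: connected_graph_def derived_graph_def)
  ultimately have *: "((u, a mod int n), (v, b mod int n)) \<in> (adj ?Y (edges ?Y))\<^sup>*"
    if "u \<in> verts X" "v \<in> verts X" for u v a b
    using that by blast
  show ?thesis
    unfolding connected_graph_def
  proof (intro ballI)
    fix x y assume "x \<in> verts ?Y" "y \<in> verts ?Y"
    then obtain u a v b where "x = (u, a)" "y = (v, b)" "u \<in> verts X" "v \<in> verts X"
      "a \<in> {0..<int n}" "b \<in> {0..<int n}"
      using n by (auto simp: mod_cover_simps)
    then show "(x, y) \<in> (adj ?Y (edges ?Y))\<^sup>*"
      using *[of u v a b] by simp
  qed
qed

text \<open>After swapping the sums over vertices and edges, each edge picks out its two ends; in
  this form the cover can be compared with the base.\<close>

lemma (in finite_serre_graph) sum_laplacian_mult: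
  assumes "u \<in> verts Y"
  shows "(\<Sum>v\<in>verts Y. laplacian Y s x u v * F v) =
    s * F u + (\<Sum>e | e \<in> edges Y \<and> origin Y e = u. F u - x e * F (terminus Y e))"
proof -
  have "laplacian Y s x u v * F v = (if u = v then s * F v else 0) +
      (\<Sum>e | e \<in> edges Y \<and> origin Y e = u.
        (if u = v then F v else 0) - (if terminus Y e = v then x e * F v else 0))" for v
    unfolding laplacian_def distrib_right sum_distrib_right
    by (intro arg_cong2[where f = "(+)"] sum.cong) (auto simp: left_diff_distrib)
  then have "(\<Sum>v\<in>verts Y. laplacian Y s x u v * F v) =
      (\<Sum>v\<in>verts Y. if u = v then s * F v else 0) +
      (\<Sum>v\<in>verts Y. \<Sum>e | e \<in> edges Y \<and> origin Y e = u.
        (if u = v then F v else 0) - (if terminus Y e = v then x e * F v else 0))"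
    by (simp add: sum.distrib)
  also have "(\<Sum>v\<in>verts Y. \<Sum>e | e \<in> edges Y \<and> origin Y e = u.
        (if u = v then F v else 0) - (if terminus Y e = v then x e * F v else 0)) =
      (\<Sum>e | e \<in> edges Y \<and> origin Y e = u. F u - x e * F (terminus Y e))"
    using assms by (subst sum.swap) (auto simp: sum_subtractf intro!: sum.cong)
  finally show ?thesis using assms by simp
qed

text \<open>The characters \<open>\<chi> b\<close> of the cyclic group block-diagonalise the Laplacian of the cyclic cover.\<close>

lemma (in finite_serre_graph) setdet_laplacian_mod_cover:
  fixes \<chi> :: "int \<Rightarrow> int \<Rightarrow> 'a :: idom" and n :: nat
  defines "N \<equiv> {0..<int n}"
  assumes \<alpha>: "voltage_assignment Y integer_group \<alpha>" and n: "n > 0" "of_nat n \<noteq> (0 :: 'a)"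
    and add: "\<And>b a a'. b \<in> N \<Longrightarrow> \<chi> b (a + a') = \<chi> b a * \<chi> b a'"
    and mod: "\<And>b a. b \<in> N \<Longrightarrow> \<chi> b (a mod int n) = \<chi> b a"
    and orth: "\<And>b b'. b \<in> N \<Longrightarrow> b' \<in> N \<Longrightarrow>
      (\<Sum>a\<in>N. \<chi> b (- a) * \<chi> b' a) = (if b = b' then of_nat n else 0)"
  shows "setdet (verts (mod_cover Y \<alpha> n)) (laplacian (mod_cover Y \<alpha> n) s (\<lambda>_. 1)) =
    (\<Prod>b\<in>N. setdet (verts Y) (laplacian Y s (\<lambda>e. \<chi> b (\<alpha> e))))"
proof -
  let ?C = "mod_cover Y \<alpha> n" and ?V = "verts Y"
  interpret C: finite_serre_graph ?C
    using mod_cover_finite_serre[OF \<alpha> n(1)] .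
  have fin: "finite N" by (simp add: N_def)
  have S: "verts ?C = ?V \<times> N"
    using n by (simp add: mod_cover_simps N_def)
  let ?S = "?V \<times> N"
  \<comment> \<open>\<open>P\<close> is the character table of the cyclic group repeated over the
    vertices, \<open>Q\<close> is its inverse up to the factor \<open>n\<close>, and
    \<open>B\<close> has the twisted base matrices as diagonal blocks.\<close>
  define P :: "'v \<times> int \<Rightarrow> 'v \<times> int \<Rightarrow> 'a" where
    "P = (\<lambda>(v, a) (w, b). if v = w then \<chi> b a else 0)"
  define Q :: "'v \<times> int \<Rightarrow> 'v \<times> int \<Rightarrow> 'a" where
    "Q = (\<lambda>(w, b) (v, a). if w = v then \<chi> b (- a) else 0)"
  define L where "L b = laplacian Y s (\<lambda>e. \<chi> b (\<alpha> e))" for b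
  define B :: "'v \<times> int \<Rightarrow> 'v \<times> int \<Rightarrow> 'a" where
    "B = (\<lambda>(v, b) (w, c). if b = c then L b v w else 0)"
  have out: "{e' \<in> edges ?C. origin ?C e' = (v, a)} = (\<lambda>e. (e, a)) ` {e \<in> edges Y. origin Y e = v}"
    if "a \<in> N" for v a
    using n that by (auto simp: mod_cover_simps N_def)
  have "setdet ?S (laplacian ?C s (\<lambda>_. 1)) * setdet ?S P =
      setdet ?S (\<lambda>i k. \<Sum>j\<in>?S. laplacian ?C s (\<lambda>_. 1) i j * P j k)"
    by (rule setdet_mult[symmetric]) (simp add: fin)
  also have "\<dots> = setdet ?S (\<lambda>i k. \<Sum>j\<in>?S. P i j * B j k)"
  proof (rule setdet_cong)
    fix i k assume "i \<in> ?S" "k \<in> ?S"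
    then obtain v a w b where i: "i = (v, a)" "v \<in> ?V" "a \<in> N" and k: "k = (w, b)" "w \<in> ?V" "b \<in> N"
      by auto
    have "(\<Sum>j\<in>?S. laplacian ?C s (\<lambda>_. 1) i j * P j k) =
        s * P i k + (\<Sum>e | e \<in> edges Y \<and> origin Y e = v. P i k - P (terminus Y e, (a + \<alpha> e) mod int n) k)"
      using C.sum_laplacian_mult[of i s "\<lambda>_. 1" "\<lambda>j. P j k"] i(2,3) n(1)
      unfolding S i(1) out[OF i(3)] by (simp add: sum.reindex inj_on_def mod_cover_simps)
    \<comment> \<open>Following \<open>e\<close> shifts the sheet by \<open>\<alpha> e\<close>,
      which multiplies the character by \<open>\<chi> b (\<alpha> e)\<close>.\<close>
    also have "\<dots> = \<chi> b a * L b v w"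
      using k(3) by (simp add: P_def i(1) k(1) L_def laplacian_def mod add ring_distribs sum_distrib_left
          right_diff_distrib mult.commute if_distrib cong: if_cong sum.cong)
    also have "\<dots> = (\<Sum>u\<in>?V. \<Sum>c\<in>N. P i (u, c) * B (u, c) k)"
    proof -
      have "(\<Sum>c\<in>N. P i (u, c) * B (u, c) k) = (if v = u then \<chi> b a * L b u w else 0)" for u
        using k(3) fin by (simp add: P_def B_def i(1) k(1) if_distrib cong: if_cong)
      then show ?thesis using i(2) by simp
    qed
    also have "\<dots> = (\<Sum>j\<in>?S. P i j * B j k)"
      by (simp add: sum.cartesian_product)
    finally show "(\<Sum>j\<in>?S. laplacian ?C s (\<lambda>_. 1) i j * P j k) = (\<Sum>j\<in>?S. P i j * B j k)" .
  qed
  also have "\<dots> = setdet ?S P * setdet ?S B"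
    by (rule setdet_mult) (simp add: fin)
  finally have eq: "setdet ?S P * setdet ?S (laplacian ?C s (\<lambda>_. 1)) = setdet ?S P * setdet ?S B"
    by (simp add: mult.commute)
  \<comment> \<open>Orthogonality of the characters shows that \<open>setdet ?S P\<close> is
    nonzero, so that it can be cancelled from \<open>eq\<close>.\<close>
  have "setdet ?S Q * setdet ?S P = setdet ?S (\<lambda>i k. \<Sum>j\<in>?S. Q i j * P j k)"
    by (rule setdet_mult[symmetric]) (simp add: fin)
  also have "\<dots> = setdet ?S (\<lambda>i k. if i = k then of_nat n else 0)"
  proof (rule setdet_cong)
    fix i k assume "i \<in> ?S" "k \<in> ?S"
    then obtain v a w b where i: "i = (v, a)" "v \<in> ?V" "a \<in> N" and k: "k = (w, b)" "w \<in> ?V" "b \<in> N"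
      by auto
    have "(\<Sum>j\<in>?S. Q i j * P j k) = (\<Sum>u\<in>?V. \<Sum>c\<in>N. Q i (u, c) * P (u, c) k)"
      by (simp add: sum.cartesian_product)
    also have "\<dots> = (\<Sum>u\<in>?V. if v = u then (if v = w then \<Sum>c\<in>N. \<chi> a (- c) * \<chi> b c else 0) else 0)"
      by (intro sum.cong) (auto simp: Q_def P_def i(1) k(1))
    also have "\<dots> = (if i = k then of_nat n else 0)"
      using i k orth by simp
    finally show "(\<Sum>j\<in>?S. Q i j * P j k) = (if i = k then of_nat n else 0)" .
  qed
  also have "\<dots> = of_nat n ^ card ?S"
    by (subst setdet_triangular[where d = "\<lambda>_. 0"]) (auto simp: fin)
  finally have "setdet ?S P \<noteq> 0"
    using n(2) by auto
  with eq have "setdet ?S (laplacian ?C s (\<lambda>_. 1)) = setdet ?S B"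
    by simp
  also have "\<dots> = (\<Prod>b\<in>N. setdet ?V (L b))"
    unfolding B_def by (rule setdet_block_diagonal) (simp_all add: fin)
  finally show ?thesis by (simp add: S L_def)
qed

section \<open>Characters given by roots of unity and the tree count of the cover\<close>

lemma sum_unity_root_powers:
  fixes w :: "'a :: field"
  assumes "w ^ n = 1" "n > 0"
  shows "(\<Sum>a\<in>{0..<int n}. w powi a) = (if w = 1 then of_nat n else 0)"
proof -
  have "(\<Sum>a\<in>{0..<int n}. w powi a) = (\<Sum>i<n. w ^ i)"
    by (rule sum.reindex_bij_witness[of _ int nat]) (auto simp: power_int_def)
  moreover have "(w - 1) * (\<Sum>i<n. w ^ i) = 0"
    using power_diff_1_eq[of w n] assms(1) by simp
  ultimately show ?thesis by auto
qed

lemma poly_setdet: "poly (setdet S M) x = setdet S (\<lambda>i j. poly (M i j) x)"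
  by (simp add: setdet_def poly_sum poly_prod)

lemma poly_laplacian: "poly (laplacian Y [:0, 1:] (\<lambda>e. [:f e:]) u v) x = laplacian Y x f u v"
  unfolding laplacian_def by (auto simp: poly_sum intro!: sum.cong)

lemma sum_const_poly: "(\<Sum>a\<in>A. [:f a:]) = [:\<Sum>a\<in>A. f a:]"
  by (induction A rule: infinite_finite_induct) auto

lemma unity_root_powi_mod:
  fixes z :: "'a :: field"
  assumes "z ^ n = 1" "n > 0"
  shows "z powi (a mod int n) = z powi a"
proof -
  have "z \<noteq> 0" using assms by (auto simp: power_0_left)
  have "z powi a = z powi (int n * (a div int n) + a mod int n)" by simp
  also have "\<dots> = (z powi int n) powi (a div int n) * z powi (a mod int n)"
    using \<open>z \<noteq> 0\<close> by (subst power_int_add) (simp_all add: power_int_mult)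
  finally show ?thesis using assms(1) by simp
qed

text \<open>The factor at \<open>z = 1\<close> is the untwisted determinant of \<open>Y\<close>. It
  and the determinant of the cover have no constant term, so in degree 1 the remaining factors enter
  only through their values at \<open>s = 0\<close>. The number of vertices of \<open>Y\<close>
  cancels.\<close>

lemma (in finite_serre_graph) num_spanning_trees_mod_cover:
  assumes \<alpha>: "voltage_assignment Y integer_group \<alpha>" and n: "n > 0" and ne: "verts Y \<noteq> {}"
  shows "of_nat n * of_nat (num_spanning_trees (mod_cover Y \<alpha> n)) =
    of_nat (num_spanning_trees Y) *
    (\<Prod>z\<in>unity_roots n - {1 :: 'a :: {alg_closed_field, field_char_0}}.
       setdet (verts Y) (laplacian Y 0 (\<lambda>e. z powi \<alpha> e)))"
proof -
  let ?C = "mod_cover Y \<alpha> n" and ?Z = "unity_roots n :: 'a set" and ?N = "{0..<int n}"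
  interpret C: finite_serre_graph ?C
    using mod_cover_finite_serre[OF \<alpha> n] .
  have fin: "finite ?Z" using proots_unity(4)[OF n] .
  have "card ?N = card ?Z" by (simp add: card_unity_roots[OF n])
  \<comment> \<open>Any bijection onto the roots of unity may index the characters, since
    orthogonality only compares whether two of the \<open>c b\<close> are equal.\<close>
  then obtain c where c: "bij_betw c ?N ?Z"
    using finite_same_card_bij[of ?N ?Z] fin by auto
  have cZ: "c b ^ n = 1" "c b \<noteq> 0" if "b \<in> ?N" for b
  proof -
    show "c b ^ n = 1" using bij_betwE[OF c] that by (auto simp: unity_roots_def)
    then show "c b \<noteq> 0" using n by (auto simp: power_0_left)
  qed
  define D where "D z = setdet (verts Y) (laplacian Y [:0, 1:] (\<lambda>e. [:z powi \<alpha> e:]))" for z :: 'a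
  have orth: "(\<Sum>a\<in>?N. [:c b powi (- a):] * [:c b' powi a:]) = (if b = b' then of_nat n else 0)"
    if b: "b \<in> ?N" "b' \<in> ?N" for b b'
  proof -
    have "(\<Sum>a\<in>?N. [:c b powi (- a):] * [:c b' powi a:]) = [:\<Sum>a\<in>?N. (c b' / c b) powi a:]"
      using cZ[OF b(1)] by (simp add: sum_const_poly power_int_divide_distrib power_int_minus field_simps)
    also have "(\<Sum>a\<in>?N. (c b' / c b) powi a) = (if c b' / c b = 1 then of_nat n else 0)"
      using cZ b n by (intro sum_unity_root_powers) (simp_all add: power_divide)
    also have "c b' / c b = 1 \<longleftrightarrow> b = b'"
      using cZ b c by (auto simp: bij_betw_def inj_on_eq_iff)
    finally show ?thesis by (simp add: of_nat_poly)
  qed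
  have "setdet (verts ?C) (laplacian ?C [:0, 1:] (\<lambda>_. 1)) = (\<Prod>b\<in>?N. D (c b))"
    unfolding D_def
  proof (rule setdet_laplacian_mod_cover[OF \<alpha> n])
    show "of_nat n \<noteq> (0 :: 'a poly)" using n by simp
    show "[:c b powi (a + a'):] = [:c b powi a:] * [:c b powi a':]" if "b \<in> ?N" for b a a'
      using cZ[OF that] by (simp add: power_int_add)
    show "[:c b powi (a mod int n):] = [:c b powi a:]" if "b \<in> ?N" for b a
      using unity_root_powi_mod[OF cZ(1)[OF that] n] by simp
  qed (use orth in simp)
  also have "\<dots> = (\<Prod>z\<in>?Z. D z)"
    using c by (rule prod.reindex_bij_betw)
  also have "?Z = insert 1 (?Z - {1})"
    by (auto simp: unity_roots_def)
  also have "(\<Prod>z\<in>\<dots>. D z) = D 1 * (\<Prod>z\<in>?Z - {1}. D z)"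
    using fin by (subst prod.insert) auto
  also have "D 1 = setdet (verts Y) (laplacian Y [:0, 1:] (\<lambda>_. 1))"
    by (simp add: D_def one_pCons)
  finally have eq: "setdet (verts ?C) (laplacian ?C [:0, 1:] (\<lambda>_. 1)) =
      setdet (verts Y) (laplacian Y [:0, 1:] (\<lambda>_. 1)) * (\<Prod>z\<in>?Z - {1}. D z)" .
  have D0: "coeff (\<Prod>z\<in>?Z - {1}. D z) 0 =
      (\<Prod>z\<in>?Z - {1}. setdet (verts Y) (laplacian Y 0 (\<lambda>e. z powi \<alpha> e)))"
    by (simp add: poly_0_coeff_0[symmetric] poly_prod D_def poly_setdet poly_laplacian)
  have "verts ?C \<noteq> {}" using ne n by (simp add: mod_cover_simps)
  from arg_cong[OF eq, of "\<lambda>f. coeff f 1"] C.matrix_tree[where 'a = 'a, OF this] matrix_tree[where 'a = 'a, OF ne]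
  have "of_nat (card (verts ?C) * num_spanning_trees ?C) =
      of_nat (card (verts Y) * num_spanning_trees Y) * coeff (\<Prod>z\<in>?Z - {1}. D z) 0"
    by (simp add: coeff_mult)
  then have "of_nat (card (verts Y)) * (of_nat n * of_nat (num_spanning_trees ?C)) =
      of_nat (card (verts Y)) * (of_nat (num_spanning_trees Y) * coeff (\<Prod>z\<in>?Z - {1}. D z) 0)"
    using n by (simp add: mod_cover_simps card_cartesian_product mult_ac)
  then show ?thesis
    unfolding D0 using ne by simp
qed

section \<open>Evaluation of Laurent polynomials\<close>

definition laurent_eval :: "'a \<Rightarrow> int_laurent \<Rightarrow> 'a :: field_char_0" where
  "laurent_eval z L = (\<Sum>k\<in>Poly_Mapping.keys L. of_int (Poly_Mapping.lookup L k) * z powi k)"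

lemma laurent_eval_superset:
  assumes "finite A" "Poly_Mapping.keys L \<subseteq> A"
  shows "laurent_eval z L = (\<Sum>k\<in>A. of_int (Poly_Mapping.lookup L k) * z powi k)"
  unfolding laurent_eval_def using assms
  by (intro sum.mono_neutral_left) (auto simp: in_keys_iff)

lemma laurent_eval_single [simp]: "laurent_eval z (Poly_Mapping.single k c) = of_int c * z powi k"
  by (simp add: laurent_eval_superset[of "{k}"])

lemma laurent_eval_0 [simp]: "laurent_eval z 0 = 0"
  by (simp add: laurent_eval_def)

lemma laurent_eval_add: "laurent_eval z (L + M) = laurent_eval z L + laurent_eval z M"
proof -
  let ?A = "Poly_Mapping.keys L \<union> Poly_Mapping.keys M"
  have "laurent_eval z K = (\<Sum>k\<in>?A. of_int (Poly_Mapping.lookup K k) * z powi k)"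
    if "K \<in> {L, M, L + M}" for K
    using that keys_add[of L M] by (intro laurent_eval_superset) auto
  then show ?thesis
    by (simp add: lookup_add distrib_right sum.distrib)
qed

lemma laurent_eval_sum: "laurent_eval z (\<Sum>i\<in>A. f i) = (\<Sum>i\<in>A. laurent_eval z (f i))"
  by (induction A rule: infinite_finite_induct) (simp_all add: laurent_eval_add)

lemma laurent_eval_mult:
  assumes "z \<noteq> 0"
  shows "laurent_eval z (L * M) = laurent_eval z L * laurent_eval z M"
proof -
  have "L * M = (\<Sum>k\<in>Poly_Mapping.keys L. \<Sum>l\<in>Poly_Mapping.keys M.
      Poly_Mapping.single (k + l) (Poly_Mapping.lookup L k * Poly_Mapping.lookup M l))"
    by (subst poly_mapping_eq_sum_single[of L], subst poly_mapping_eq_sum_single[of M])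
       (simp add: sum_product mult_single)
  then have "laurent_eval z (L * M) = (\<Sum>k\<in>Poly_Mapping.keys L. \<Sum>l\<in>Poly_Mapping.keys M.
      (of_int (Poly_Mapping.lookup L k) * z powi k) * (of_int (Poly_Mapping.lookup M l) * z powi l))"
    using assms by (simp add: laurent_eval_sum power_int_add mult_ac)
  then show ?thesis
    by (simp add: laurent_eval_def sum_product)
qed

lemma laurent_eval_hom:
  assumes "z \<noteq> 0"
  shows "comm_ring_hom (laurent_eval z)"
proof
  show "laurent_eval z 1 = 1"
    using laurent_eval_single[of z 0 1] by (simp add: single_one)
qed (simp_all add: laurent_eval_add laurent_eval_mult[OF assms])

text \<open>Evaluation at a nonzero \<open>z\<close> is a ring homomorphism and passes through the
  determinant; entrywise it yields the Laplacian twisted by \<open>z\<close>.\<close>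

lemma laurent_eval_ihara:
  assumes X: "finite_graph X" and vs: "distinct vs" "set vs = verts X" and z: "z \<noteq> 0"
  shows "laurent_eval z (ihara X vs \<alpha>) = setdet (verts X) (laplacian X 0 (\<lambda>e. z powi \<alpha> e))"
proof -
  interpret comm_ring_hom "laurent_eval z"
    using laurent_eval_hom[OF z] .
  have h: "bij_betw ((!) vs) {0..<length vs} (verts X)"
    using bij_betw_nth[OF vs(1), of "{0..<length vs}" "verts X"] vs(2) by (simp add: atLeast0LessThan)
  have fin: "finite {e \<in> edges X. P e}" for P
    using X by (simp add: finite_graph_def)
  have "map_mat (laurent_eval z) (degree_mat X vs - adjacency_mat X vs \<alpha>) =
      mat (length vs) (length vs) (\<lambda>(i, j). laplacian X 0 (\<lambda>e. z powi \<alpha> e) (vs ! i) (vs ! j))"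
  proof (rule eq_matI)
    fix i j assume "i < dim_row (mat (length vs) (length vs)
        (\<lambda>(i, j). laplacian X 0 (\<lambda>e. z powi \<alpha> e) (vs ! i) (vs ! j)))"
      "j < dim_col (mat (length vs) (length vs)
        (\<lambda>(i, j). laplacian X 0 (\<lambda>e. z powi \<alpha> e) (vs ! i) (vs ! j)))"
    then have ij: "i < length vs" "j < length vs" by simp_all
    have "{e \<in> edges X. origin X e = vs ! i} \<inter> {e. terminus X e = vs ! j} =
        {e \<in> edges X. origin X e = vs ! i \<and> terminus X e = vs ! j}"
      by auto
    then show "map_mat (laurent_eval z) (degree_mat X vs - adjacency_mat X vs \<alpha>) $$ (i, j) =
        mat (length vs) (length vs) (\<lambda>(i, j). laplacian X 0 (\<lambda>e. z powi \<alpha> e) (vs ! i) (vs ! j)) $$ (i, j)"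
      using ij vs(1) fin
      by (simp add: degree_mat_def adjacency_mat_def laplacian_def hom_minus laurent_eval_sum
          sum_subtractf nth_eq_iff_index_eq sum.If_cases hom_of_nat)
  qed (simp_all add: degree_mat_def adjacency_mat_def)
  then show ?thesis
    unfolding ihara_def hom_det[symmetric] setdet_eq_det_enum[OF h] by simp
qed

lemma poly_laurent_shift:
  assumes z: "z \<noteq> 0"
  shows "poly (map_poly of_int (laurent_shift L)) z = z powi (- laurent_ord0 L) * laurent_eval z L"
proof -
  have "laurent_eval z (laurent_of_poly f) = poly (map_poly of_int f) z" for f
    by (simp add: laurent_of_poly_def laurent_eval_sum poly_altdef degree_map_poly coeff_map_poly)
  then show ?thesis
    by (metis laurent_of_poly_shift laurent_eval_mult[OF z] laurent_eval_single mult_1 of_int_1)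
qed

section \<open>The formula for the number of spanning trees\<close>

text \<open>Cancel \<open>t - 1\<close> from two factorisations of \<open>t^n - 1\<close> and
  evaluate at 1, where the geometric sum has \<open>n\<close> terms equal to 1.\<close>

lemma prod_one_minus_unity_roots:
  assumes "n > 0"
  shows "(\<Prod>z\<in>unity_roots n - {1 :: 'a :: {alg_closed_field, field_char_0}}. 1 - z) = of_nat n"
proof -
  let ?Z = "unity_roots n :: 'a set"
  have fin: "finite ?Z" using proots_unity(4)[OF assms] .
  have "monom 1 n - 1 = (\<Prod>z\<in>?Z. [:-z, 1:])"
    using alg_closed_factorization(1)[OF proots_unity(1)[OF assms, where 'a = 'a]]
      proots_unity(2,5)[OF assms, where 'a = 'a]
    by (simp add: prod_unfold_prod_mset)
  also have "?Z = insert 1 (?Z - {1})"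
    by (auto simp: unity_roots_def)
  also have "(\<Prod>z\<in>\<dots>. [:-z, 1:]) = [:-1, 1:] * (\<Prod>z\<in>?Z - {1}. [:-z, 1:])"
    using fin by (subst prod.insert) auto
  also have "monom 1 n - 1 = [:-1, 1 :: 'a:] * (\<Sum>i<n. [:0, 1:] ^ i)"
    using power_diff_1_eq[of "[:0, 1 :: 'a:]" n] by (simp add: monom_altdef one_pCons)
  finally have "(\<Sum>i<n. [:0, 1 :: 'a:] ^ i) = (\<Prod>z\<in>?Z - {1}. [:-z, 1:])"
    by (simp only: mult_cancel_left) simp
  from arg_cong[OF this, of "\<lambda>f. poly f 1"] show ?thesis
    by (simp add: poly_sum poly_prod)
qed

lemma prod_mset_prod_swap:
  "(\<Prod>x\<in>A. \<Prod>y\<in>#M. f x y) = (\<Prod>y\<in>#M. \<Prod>x\<in>A. f x y :: 'a :: comm_monoid_mult)"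
  by (induction M) (simp_all add: prod.distrib)

text \<open>Both sides are the resultant of \<open>f\<close> and \<open>t^n - 1\<close>, computed
  over either set of roots; the absolute value hides the sign.\<close>

lemma (in padic_closure) absv_prod_poly_unity_roots:
  assumes "n > 0" "f \<noteq> 0"
  shows "absv (\<Prod>z\<in>unity_roots n. poly f z) = absv (lead_coeff f ^ n * (\<Prod>\<beta>\<in>#proots f. \<beta> ^ n - 1))"
proof -
  have "absv (\<Prod>z\<in>unity_roots n. poly f z) =
      (\<Prod>z\<in>unity_roots n. absv (lead_coeff f) * (\<Prod>\<beta>\<in>#proots f. absv (\<beta> - z)))"
    by (simp add: absv_prod poly_alg_closed_factorization[OF assms(2)] absv_mult absv_prod_mset
        absv_diff_commute)
  also have "\<dots> = absv (lead_coeff f) ^ n * (\<Prod>\<beta>\<in>#proots f. \<Prod>z\<in>unity_roots n. absv (\<beta> - z))"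
    by (simp add: prod.distrib card_unity_roots[OF assms(1)] prod_mset_prod_swap)
  finally show ?thesis
    by (simp add: absv_mult absv_power absv_prod_mset prod_unity_roots[OF assms(1), symmetric] absv_prod)
qed

text \<open>The defining product is the value at 1 up to sign. In particular it is an integer, so
  the description in \<open>pierce_lehmer\<close> denotes it.\<close>

lemma pierce_lehmer_1:
  assumes "f \<noteq> 0"
  shows "pierce_lehmer 1 f = (- 1) ^ degree f * poly f 1"
proof -
  let ?g = "map_poly of_int f :: complex poly"
  have g: "?g \<noteq> 0" "degree ?g = degree f" "lead_coeff ?g = of_int (lead_coeff f)"
    using assms by (simp_all add: degree_map_poly coeff_map_poly)
  have "(\<Prod>x\<in>#M. x - 1) = (- 1) ^ size M * (\<Prod>x\<in>#M. 1 - x)" for M :: "complex multiset"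
    by (induction M) (simp_all add: algebra_simps)
  then have "of_int (lead_coeff f) ^ 1 * (\<Prod>x\<in>#proots ?g. x ^ 1 - 1) =
      (- 1) ^ degree f * (lead_coeff ?g * (\<Prod>x\<in>#proots ?g. 1 - x))"
    using alg_closed_factorization(2)[OF g(1)] by (simp add: g)
  also have "\<dots> = (- 1) ^ degree f * poly ?g 1"
    by (simp only: poly_alg_closed_factorization[OF g(1)])
  also have "\<dots> = of_int ((- 1) ^ degree f * poly f 1)"
    using of_int_hom.poly_map_poly[of f 1, where 'a = complex] by simp
  finally show ?thesis
    unfolding pierce_lehmer_def by (intro the_equality) (simp_all only: of_int_eq_iff)
qed

lemma order_decomp_nonzero:
  fixes f g :: "'a :: idom poly"
  assumes "f = [:-a, 1:] ^ order a f * g" "f \<noteq> 0"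
  shows "poly g a \<noteq> 0"
proof
  assume "poly g a = 0"
  then have "[:-a, 1:] ^ Suc (order a f) dvd [:-a, 1:] ^ order a f * g"
    by (simp only: power_Suc2 poly_eq_0_iff_dvd mult_dvd_mono dvd_refl)
  then show False
    using order_2[OF assms(2), of a] assms(1) by simp
qed

lemma sum_mset_ereal:
  "(\<And>x. x \<in># M \<Longrightarrow> g x = ereal (h x)) \<Longrightarrow> (\<Sum>x\<in>#M. g x) = ereal (\<Sum>x\<in>#M. h x)"
  by (induction M) simp_all

theorem theorem3p17:
  fixes X :: "('v, 'e) pregraph"
    and \<alpha> :: "'e \<Rightarrow> int"
    and vs :: "'v list"
    and p n :: nat
    and absv :: "'k :: {alg_closed_field, field_char_0} \<Rightarrow> real"
  assumes "serre_graph X"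
    and "finite_graph X"
    and "connected_graph X"
    and "euler_char X \<noteq> 0"
    and "voltage_assignment X integer_group \<alpha>"
    and "connected_graph (derived_graph X integer_group \<alpha>)"
    and "distinct vs" and "set vs = verts X"
    and "padic_closure p absv"
    and "n \<ge> 1"
  shows "padic_ord p absv (of_nat (num_spanning_trees (mod_cover X \<alpha> n))) =
    ereal (mu_inv p absv X vs \<alpha> * real n)
    + ereal (real_of_int (lambda_inv absv X vs \<alpha> n)) * padic_ord p absv (of_nat n)
    + nu_inv p absv X vs \<alpha> n + c_inv p absv X vs \<alpha>"
proof -
  interpret finite_serre_graph X
    using assms(1,2) by unfold_locales
  interpret padic_closure p absv
    using assms(9) .
  have n: "n > 0" using assms(10) by simp
  \<comment> \<open>A nonzero Euler characteristic rules out the empty graph.\<close>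
  have ne: "verts X \<noteq> {}"
  proof
    assume "verts X = {}"
    then have "edges X = {}" using edge(1) by blast
    with \<open>verts X = {}\<close> assms(4) show False by (simp add: euler_char_def)
  qed
  define K where "K = num_spanning_trees X"
  define Kc where "Kc m = num_spanning_trees (mod_cover X \<alpha> m)" for m
  define I where "I z = laurent_eval z (ihara X vs \<alpha>)" for z :: 'k
  have K: "K > 0"
    unfolding K_def using num_spanning_trees_pos[OF assms(3) ne] .
  have Kc: "Kc m > 0" if "m > 0" for m
  proof -
    interpret C: finite_serre_graph "mod_cover X \<alpha> m"
      using mod_cover_finite_serre[OF assms(5) that] .
    have "verts (mod_cover X \<alpha> m) \<noteq> {}"
      using ne that by (simp add: mod_cover_simps)
    then show ?thesis
      unfolding Kc_def using C.num_spanning_trees_pos connected_mod_cover[OF assms(6) that] by blast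
  qed
  have unity_nz: "z \<noteq> 0" if "z \<in> unity_roots m" "m > 0" for z :: 'k and m
    using that by (auto simp: unity_roots_def power_0_left)
  have trees: "of_nat m * of_nat (Kc m) = of_nat K * (\<Prod>z\<in>unity_roots m - {1}. I z)" if "m > 0" for m
    unfolding Kc_def K_def num_spanning_trees_mod_cover[OF assms(5) that ne, where 'a = 'k]
    using that unity_nz
    by (intro arg_cong2[where f = "(*)"] prod.cong refl)
       (auto simp: I_def laurent_eval_ihara[OF assms(2,7,8)])
  have fin: "finite (unity_roots m :: 'k set)" if "m > 0" for m
    using proots_unity(4)[OF that] .
  \<comment> \<open>The covers are connected and so have spanning trees; hence no factor of the
    product formula vanishes.\<close>
  have I_nz: "I z \<noteq> 0" if "z \<in> unity_roots m" "z \<noteq> 1" "m > 0" for z m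
  proof -
    have "of_nat m * of_nat (Kc m) \<noteq> (0 :: 'k)"
      using Kc[OF that(3)] that(3) by simp
    then show ?thesis
      unfolding trees[OF that(3)] using fin[OF that(3)] that by auto
  qed
  define G where "G = laurent_shift (ihara X vs \<alpha>)"
  define e where "e = J_exp X vs \<alpha>"
  define J where "J = J_poly X vs \<alpha>"
  define f where "f = (J_padic X vs \<alpha> :: 'k poly)"
  have GJ: "G = [:-1, 1:] ^ e * J"
    unfolding G_def e_def J_def by (rule J_poly_mult[symmetric])
  have f: "f = map_poly of_int J"
    by (simp add: f_def J_padic_def J_def)
  have eval: "(z - 1) ^ e * poly f z = z powi (- laurent_ord0 (ihara X vs \<alpha>)) * I z" if "z \<noteq> 0" for z
  proof -
    have "map_poly of_int G = (map_poly of_int [:-1, 1:] ^ e * f :: 'k poly)"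
      unfolding GJ f by (simp add: hom_distribs)
    then show ?thesis
      using poly_laurent_shift[OF that, of "ihara X vs \<alpha>"] by (simp add: G_def I_def)
  qed
  \<comment> \<open>The double cover, whose only nontrivial character is \<open>-1\<close>, shows
    that the Ihara polynomial is not zero.\<close>
  have "I (- 1) \<noteq> 0"
    using I_nz[of "- 1" 2] by (simp add: unity_roots_def)
  then have "f \<noteq> 0"
    using eval[of "- 1"] by auto
  then have "J \<noteq> 0"
    by (auto simp: f)
  \<comment> \<open>\<open>J\<close> is what remains once every factor \<open>t - 1\<close> has been
    removed.\<close>
  have J1: "poly J 1 \<noteq> 0"
  proof (rule order_decomp_nonzero)
    show "G = [:-1, 1:] ^ order 1 G * J"
      using GJ by (simp add: e_def J_exp_def laurent_ord1_def G_def)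
    show "G \<noteq> 0"
      using GJ \<open>J \<noteq> 0\<close> by simp
  qed
  have f1: "poly f 1 = of_int (poly J 1)"
    using of_int_hom.poly_map_poly[of J 1] by (simp add: f)
  have f_nz: "poly f z \<noteq> 0" if "z \<in> unity_roots n" for z
  proof (cases "z = 1")
    case False
    then show ?thesis
      using eval[of z] I_nz[OF that False n] unity_nz[OF that n] by auto
  qed (use f1 J1 in simp)
  \<comment> \<open>Powers of \<open>z\<close> have absolute value 1, so the shift by a monomial
    disappears.\<close>
  have absI: "absv (I z) = absv (1 - z) ^ e * absv (poly f z)" if "z \<in> unity_roots n" for z
  proof -
    have z: "absv z = 1" "z \<noteq> 0"
      using that n absv_eq_1_if_power_eq_1 unity_nz by (auto simp: unity_roots_def)
    have "absv (z powi k) = 1" for k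
      using z by (auto simp: power_int_def absv_power absv_divide inverse_eq_divide)
    then show ?thesis
      using arg_cong[OF eval[OF z(2)], of absv] by (simp add: absv_mult absv_power absv_diff_commute)
  qed
  define \<Delta> where "\<Delta> = lead_coeff f ^ n * (\<Prod>\<beta>\<in>#proots f. \<beta> ^ n - 1)"
  have roots: "\<beta> ^ n \<noteq> 1" if "\<beta> \<in># proots f" for \<beta>
    using that f_nz[of \<beta>] \<open>f \<noteq> 0\<close> by (auto simp: unity_roots_def)
  then have \<Delta>: "\<Delta> \<noteq> 0"
    using \<open>f \<noteq> 0\<close> by (auto simp: \<Delta>_def prod_mset_zero_iff)
  let ?Z = "unity_roots n - {1 :: 'k}"
  have "absv (of_nat n) * absv (of_nat (Kc n)) = absv (of_nat K) * (\<Prod>z\<in>?Z. absv (I z))"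
    using arg_cong[OF trees[OF n], of absv] by (simp add: absv_mult absv_prod)
  also have "(\<Prod>z\<in>?Z. absv (I z)) = absv (of_nat n) ^ e * (\<Prod>z\<in>?Z. absv (poly f z))"
    using absI prod_one_minus_unity_roots[OF n, where 'a = 'k, symmetric]
    by (simp add: prod.distrib prod_power_distrib absv_prod)
  \<comment> \<open>The factor \<open>poly f 1\<close> supplies the missing root of unity 1 and
    completes the product to a resultant.\<close>
  finally have "absv (of_nat n * of_nat (Kc n) * poly f 1) =
      absv (of_nat K) * absv (of_nat n) ^ e * (absv (poly f 1) * (\<Prod>z\<in>?Z. absv (poly f z)))"
    by (simp add: absv_mult mult_ac)
  also have "absv (poly f 1) * (\<Prod>z\<in>?Z. absv (poly f z)) = absv (\<Prod>z\<in>unity_roots n. poly f z)"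
    using fin[OF n] by (subst absv_prod, subst prod.remove[of _ 1]) (auto simp: unity_roots_def)
  also have "\<dots> = absv \<Delta>"
    unfolding \<Delta>_def using n \<open>f \<noteq> 0\<close> by (rule absv_prod_poly_unity_roots)
  finally have "vord (of_nat n * of_nat (Kc n) * poly f 1) = vord (of_nat K * of_nat n ^ e * \<Delta>)"
    by (simp add: vord_def absv_mult absv_power)
  \<comment> \<open>The term \<open>vord (of_nat n)\<close> on the left is the source of the
    \<open>-1\<close> in \<open>lambda_inv\<close>.\<close>
  then have main: "vord (of_nat n) + vord (of_nat (Kc n)) + vord (poly f 1) =
      vord (of_nat K) + real e * vord (of_nat n) + vord \<Delta>"
    using n Kc[OF n] K \<Delta> f1 J1 by (simp add: vord_mult vord_power)
  define A where "A = {#\<beta> \<in># proots f. absv \<beta> = 1 \<and> absv (\<beta> ^ n - 1) < 1#}"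
  have A: "B_roots absv X vs \<alpha> n = A"
    unfolding B_roots_def A_def f_def[symmetric]
    using \<open>f \<noteq> 0\<close> by (intro filter_mset_cong) (auto simp: B_set_def f_def)
  let ?r = "r_inv p absv n"
  let ?\<tau> = "\<lambda>\<beta>. teichmuller p absv (residue_class absv \<beta>)"
  let ?h = "\<lambda>\<beta>. vord (\<beta> ^ (p ^ ?r \<beta>) - ?\<tau> \<beta> ^ (p ^ ?r \<beta>)) - real (?r \<beta>)"
  \<comment> \<open>No root of \<open>f\<close> satisfies \<open>\<beta> ^ n = 1\<close>, so no
    infinite order enters the sum.\<close>
  have nu: "nu_inv p absv X vs \<alpha> n = ereal (\<Sum>\<beta>\<in>#A. ?h \<beta>)"
    unfolding nu_inv_def A
  proof (rule sum_mset_ereal)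
    fix \<beta> assume "\<beta> \<in># A"
    then have "\<beta> ^ (p ^ ?r \<beta>) \<noteq> ?\<tau> \<beta> ^ (p ^ ?r \<beta>)"
      using vord_power_minus_1(2)[of \<beta> n] roots n by (auto simp: A_def)
    then show "padic_ord p absv (\<beta> ^ (p ^ ?r \<beta>) - ?\<tau> \<beta> ^ (p ^ ?r \<beta>)) - ereal (real (?r \<beta>)) = ereal (?h \<beta>)"
      by (simp add: padic_ord_eq_vord)
  qed
  have mu: "mu_inv p absv X vs \<alpha> * real n = - real n * log (real p) (padic_mahler absv f)"
    by (simp add: mu_inv_def log_padic_mahler_def f_def log_def)
  have lambda: "real_of_int (lambda_inv absv X vs \<alpha> n) = real (size A) + real e - 1"
    by (simp add: lambda_inv_def A e_def)
  \<comment> \<open>Up to sign this is the factor \<open>poly f 1\<close> by which the product was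
    completed, and \<open>c_inv\<close> subtracts its order.\<close>
  have "absv (of_int (pierce_lehmer 1 J)) = absv (poly f 1)"
    unfolding pierce_lehmer_1[OF \<open>J \<noteq> 0\<close>] f1 by (cases "even (degree J)") simp_all
  then have c: "c_inv p absv X vs \<alpha> = ereal (vord (of_nat K) - vord (poly f 1))"
    using K J1 pierce_lehmer_1[OF \<open>J \<noteq> 0\<close>]
    by (simp add: c_inv_def K_def[symmetric] J_def[symmetric] padic_ord_eq_vord vord_def)
  have "vord \<Delta> = - real n * log (real p) (padic_mahler absv f) + real (size A) * vord (of_nat n) +
      (\<Sum>\<beta>\<in>#A. ?h \<beta>)"
    unfolding \<Delta>_def A_def using vord_prod_power_minus_1[OF \<open>f \<noteq> 0\<close> n roots] vord_of_nat[OF n] by simp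
  then have "vord (of_nat (Kc n)) = mu_inv p absv X vs \<alpha> * real n +
      (real (size A) + real e - 1) * vord (of_nat n) + (\<Sum>\<beta>\<in>#A. ?h \<beta>) +
      (vord (of_nat K) - vord (poly f 1))"
    using main unfolding mu by (simp add: algebra_simps)
  then show ?thesis
    using Kc[OF n] n unfolding nu c lambda Kc_def[symmetric]
    by (simp add: padic_ord_eq_vord)
qed

end
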